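(* Let $(X,d)$ be a metric space, let $f_n:X\to X$, $n\ge0$, be maps, let $A=(a_{ij})_{N\times N}$ be a transition matrix, and let $V_i$, $1\le i\le N$, be nonempty subsets of $X$ with $d(V_i,V_j)>0$ for all $1\le i\neq j\le N$. Assume that there exist nonempty compact subsets $V_{i,n}$ of $X$ with $V_{i,n}\subset V_i$, $1\le i\le N$, $n\ge0$, such that $\{f_n\}_{n=0}^\infty$ is equi-continuous in $E:=\bigcup_{n=0}^{\infty}\bigcup_{i=1}^{N}V_{i,n}$ and, with $V_\alpha^{m,n}:=\bigcap_{k=0}^{m}f_n^{-k}(V_{a_k,n+k})$ for $\alpha=(a_0,a_1,\dots)\in\Sigma_N^+(A)$: - $V_\alpha^{m,n}\neq\emptyset$ for all $m,n\ge0$ and all $\alpha\in\Sigma_N^+(A)$; - for every $\alpha\in\Sigma_N^+(A)$, the diameter $d(V_\alpha^{m,n})$ converges to $0$ as $m\to\infty$ uniformly with respect to $n\ge0$. Then for every $n\ge0$ there exists a nonempty compact subset $\Lambda_n\subset\bigcup_{i=1}^N V_{i,n}$ with $f_n(\Lambda_n)=\Lambda_{n+1}$ such that the invariant subsystem of $x_{n+1}=f_n(x_n)$ on $\{\Lambda_n\}_{n=0}^\infty$ is topologically equi-conjugate to $(\Sigma_N^+(A),\sigma_A)$. Consequently, if $(X,d)$ is compact, then $h(f_{0,\infty},\Lambda_0)=\log\rho(A)$. Further, if $A$ is irreducible and $\sum_{j=1}^N a_{i_0j}\ge2$ for some $1\le i_0\le N$, then the system $x_{n+1}=f_n(x_n)$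 is Li-Yorke $\delta$-chaotic for some $\delta>0$, and is also distributionally chaotic.
   Context: $f_{0,\infty}:=\{f_n\}_{n=0}^\infty$. Notation: $f_i^n:=f_{i+n-1}\circ\cdots\circ f_i$ for $n\ge1$, $f_i^0$ is the identity, and $f_i^{-n}:=(f_i^n)^{-1}$ (preimage). $d(B)$ is the diameter of $B$ and $d(B,C):=\inf\{d(b,c):b\in B,c\in C\}$. A sequence of maps $h_n:\Lambda_n\to Y$ into a metric space $(Y,e)$ is equi-continuous in $\{\Lambda_n\}_{n=0}^\infty$ if for every $\epsilon>0$ there is $\delta>0$ such that $e(h_n(x),h_n(y))<\epsilon$ for all $n\ge0$ and all $x,y\in\Lambda_n$ at distance less than $\delta$; "equi-continuous in $E$" means this with $\Lambda_n=E$ for all $n$. A transition matrix is a matrix $A=(a_{ij})_{N\times N}$, $N\ge2$, with $a_{ij}\in\{0,1\}$, $\sum_{j=1}^N a_{ij}\ge1$ for all $i$ and $\sum_{i=1}^N a_{ij}\ge1$ for all $j$; it is irreducible if for each pair $1\le i,j\le N$ there is $k\ge1$ such that the $(i,j)$ entry of $A^k$ is positive. $\Sigma_N^+(A):=\{s=(s_0,s_1,\dots):1\le s_j\le N,\ a_{s_js_{j+1}}=1,\ j\ge0\}$, with metric $\hat\rho(\alpha,\beta):=\sum_{i=0}^\infty \hat d(a_i,b_i)/2^i$ for $\alpha=(a_0,a_1,\dots)$, $\beta=(b_0,b_1,\dots)$, where $\hat d(a,b)=0$ if $a=b$ and $1$ otherwise. $\sigma_A:\Sigma_N^+(A)\to\Sigma_N^+(A)$,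 $\sigma_A((s_0,s_1,s_2,\dots)):=(s_1,s_2,\dots)$. $\rho(A):=\lim_{n\to\infty}\|A^n\|^{1/n}$, where $\|B\|$ denotes the sum of all entries of $B$. For subsets $\Lambda_n\subset X$ with $f_n(\Lambda_n)\subset\Lambda_{n+1}$ for all $n\ge0$, the system restricted to $\{\Lambda_n\}$ is called the invariant subsystem on $\{\Lambda_n\}_{n=0}^\infty$. It is topologically equi-conjugate to $(\Sigma_N^+(A),\sigma_A)$ if there are bijections $h_n:\Lambda_n\to\Sigma_N^+(A)$, $n\ge0$, with $h_{n+1}\circ f_n=\sigma_A\circ h_n$ on $\Lambda_n$ for all $n\ge0$, such that $\{h_n\}$ is equi-continuous in $\{\Lambda_n\}$ and $\{h_n^{-1}\}$ is equi-continuous in $\Sigma_N^+(A)$. Topological entropy: for compact $X$ and nonempty $Y\subset X$, $h(f_{0,\infty},Y):=\sup_{\mathcal A}\limsup_{n\to\infty}\frac1n\log\mathcal N(\mathcal A_0^n|_Y)$, the supremum over open covers $\mathcal A$ of $X$, where $\mathcal A_0^n:=\{\bigcap_{j=0}^{n-1}f_0^{-j}(A_j):A_j\in\mathcal A\}$, $\mathcal B|_Y:=\{B\cap Y:B\in\mathcal B\}$, and $\mathcal N(\cdot)$ is the minimal cardinality of a subcover. Chaos: the system is Li-Yorke $\delta$-chaotic ($\delta>0$) if there is an uncountable set $S\subset X$ (Li-Yorke $\delta$-scrambled set) such that for any distinct $x,y\in S$, $\liminf_{n\to\infty}d(f_0^n(x),f_0^n(y))=0$ and $\limsup_{n\to\infty}d(f_0^n(x),f_0^n(y))>\delta$.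 It is distributionally chaotic if there is an uncountable set $D\subset X$ such that for any distinct $x,y\in D$: (i) $\limsup_{n\to\infty}\frac1n\sum_{i=0}^{n-1}\chi_{[0,\epsilon)}(d(f_0^i(x),f_0^i(y)))=1$ for every $\epsilon>0$, and (ii) $\liminf_{n\to\infty}\frac1n\sum_{i=0}^{n-1}\chi_{[0,\delta)}(d(f_0^i(x),f_0^i(y)))=0$ for some $\delta>0$, where $\chi$ is the characteristic function. *)

theory Defs
  imports "HOL-Analysis.Analysis"
begin

section \<open>Nonautonomous systems\<close>

text \<open>\<open>iter f i n\<close> is $f_i^n = f_{i+n-1} \circ \cdots \circ f_i$.\<close>

primrec iter :: "(nat \<Rightarrow> 'a \<Rightarrow> 'a) \<Rightarrow> nat \<Rightarrow> nat \<Rightarrow> 'a \<Rightarrow> 'a" where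
  "iter f i 0 = id"
| "iter f i (Suc n) = f (i + n) \<circ> iter f i n"

text \<open>The distance functions are explicit arguments because the metric on the sequence space
  below is not the one provided by the type class instance for functions.\<close>

definition equi_continuous_on ::
  "('a \<Rightarrow> 'a \<Rightarrow> real) \<Rightarrow> ('b \<Rightarrow> 'b \<Rightarrow> real) \<Rightarrow> (nat \<Rightarrow> 'a set) \<Rightarrow> (nat \<Rightarrow> 'a \<Rightarrow> 'b) \<Rightarrow> bool" where
  "equi_continuous_on d e \<Lambda> h \<longleftrightarrow>
     (\<forall>\<epsilon>>0. \<exists>\<delta>>0. \<forall>n. \<forall>x\<in>\<Lambda> n. \<forall>y\<in>\<Lambda> n. d x y < \<delta> \<longrightarrow> e (h n x) (h n y) < \<epsilon>)"

section \<open>Transition matrices and one-sided subshifts of finite type\<close>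

text \<open>The symbols $1, \ldots, N$ are the elements of a finite index type, with $N$ its
  cardinality.\<close>

definition transition_matrix :: "real^'n^'n \<Rightarrow> bool" where
  "transition_matrix A \<longleftrightarrow> CARD('n) \<ge> 2 \<and>
     (\<forall>i j. A $ i $ j \<in> {0, 1}) \<and>
     (\<forall>i. (\<Sum>j\<in>UNIV. A $ i $ j) \<ge> 1) \<and>
     (\<forall>j. (\<Sum>i\<in>UNIV. A $ i $ j) \<ge> 1)"

text \<open>The power operation \<open>^\<close> on vectors is componentwise, so the powers of a matrix
  are iterated matrix products.\<close>

primrec mat_power :: "real^'n^'n \<Rightarrow> nat \<Rightarrow> real^'n^'n" where
  "mat_power A 0 = mat 1"
| "mat_power A (Suc k) = A ** mat_power A k"

definition irreducible_matrix :: "real^'n^'n \<Rightarrow> bool" where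
  "irreducible_matrix A \<longleftrightarrow> (\<forall>i j. \<exists>k\<ge>1. mat_power A k $ i $ j > 0)"

definition entry_sum :: "real^'n^'n \<Rightarrow> real" where
  "entry_sum B = (\<Sum>i\<in>UNIV. \<Sum>j\<in>UNIV. B $ i $ j)"

definition matrix_rho :: "real^'n^'n \<Rightarrow> real" where
  "matrix_rho A = lim (\<lambda>n. root n (entry_sum (mat_power A n)))"

definition subshift :: "real^'n^'n \<Rightarrow> (nat \<Rightarrow> 'n) set" where
  "subshift A = {s. \<forall>j. A $ (s j) $ (s (Suc j)) = 1}"

definition shift :: "(nat \<Rightarrow> 'n) \<Rightarrow> (nat \<Rightarrow> 'n)" where
  "shift s = (\<lambda>j. s (Suc j))"

definition seq_dist :: "(nat \<Rightarrow> 'n) \<Rightarrow> (nat \<Rightarrow> 'n) \<Rightarrow> real" where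
  "seq_dist \<alpha> \<beta> = (\<Sum>i. (if \<alpha> i = \<beta> i then 0 else 1) / 2 ^ i)"

section \<open>Itinerary sets and equi-conjugacy\<close>

text \<open>\<open>itinerary_set f W \<alpha> m n\<close> is
  $V_\alpha^{m,n} = \bigcap_{k=0}^m f_n^{-k}(V_{a_k,n+k})$, where $V_{i,n}$ is \<open>W i n\<close>.\<close>

definition itinerary_set ::
  "(nat \<Rightarrow> 'a \<Rightarrow> 'a) \<Rightarrow> ('n \<Rightarrow> nat \<Rightarrow> 'a set) \<Rightarrow> (nat \<Rightarrow> 'n) \<Rightarrow> nat \<Rightarrow> nat \<Rightarrow> 'a set" where
  "itinerary_set f W \<alpha> m n = (\<Inter>k\<in>{0..m}. iter f n k -` W (\<alpha> k) (n + k))"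

definition equi_conjugate_to_subshift ::
  "(nat \<Rightarrow> 'a::metric_space \<Rightarrow> 'a) \<Rightarrow> (nat \<Rightarrow> 'a set) \<Rightarrow> real^'n^'n \<Rightarrow> bool" where
  "equi_conjugate_to_subshift f \<Lambda> A \<longleftrightarrow>
     (\<forall>n. f n ` \<Lambda> n \<subseteq> \<Lambda> (Suc n)) \<and>
     (\<exists>h. (\<forall>n. bij_betw (h n) (\<Lambda> n) (subshift A)) \<and>
          (\<forall>n. \<forall>x\<in>\<Lambda> n. h (Suc n) (f n x) = shift (h n x)) \<and>
          equi_continuous_on dist seq_dist \<Lambda> h \<and>
          equi_continuous_on seq_dist dist (\<lambda>_. subshift A) (\<lambda>n. inv_into (\<Lambda> n) (h n)))"

section \<open>Topological entropy on a subset\<close>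

definition iterated_cover ::
  "(nat \<Rightarrow> 'a \<Rightarrow> 'a) \<Rightarrow> 'a set set \<Rightarrow> nat \<Rightarrow> 'a set set" where
  "iterated_cover f \<A> n = {\<Inter>j\<in>{..<n}. iter f 0 j -` C j | C. \<forall>j<n. C j \<in> \<A>}"

definition restrict_cover :: "'a set set \<Rightarrow> 'a set \<Rightarrow> 'a set set" where
  "restrict_cover \<B> Y = (\<lambda>B. B \<inter> Y) ` \<B>"

text \<open>Minimal cardinality of a subcover of the cover \<open>\<C>\<close> of \<open>Y\<close>; it is \<open>\<infinity>\<close> if there is no
  finite subcover. This can occur since the maps are not assumed to be continuous.\<close>

definition min_subcover :: "'a set set \<Rightarrow> 'a set \<Rightarrow> enat" where
  "min_subcover \<C> Y = Inf {enat (card \<D>) | \<D>. \<D> \<subseteq> \<C> \<and> finite \<D> \<and> Y \<subseteq> \<Union>\<D>}"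

definition log_enat :: "enat \<Rightarrow> ereal" where
  "log_enat k = (case k of enat n \<Rightarrow> ereal (ln (real n)) | \<infinity> \<Rightarrow> \<infinity>)"

text \<open>Only meant for a compact ambient space and nonempty \<open>Y\<close>.\<close>

definition topological_entropy ::
  "(nat \<Rightarrow> 'a::topological_space \<Rightarrow> 'a) \<Rightarrow> 'a set \<Rightarrow> ereal" where
  "topological_entropy f Y =
     (SUP \<A>\<in>{\<A>. (\<forall>U\<in>\<A>. open U) \<and> \<Union>\<A> = UNIV}.
        limsup (\<lambda>n. ereal (1 / real n) *
                     log_enat (min_subcover (restrict_cover (iterated_cover f \<A> n) Y) Y)))"

section \<open>Chaos\<close>

text \<open>Limits superior and inferior are taken in the extended reals, as orbit distances may be
  unbounded.\<close>

definition li_yorke_chaotic :: "real \<Rightarrow> (nat \<Rightarrow> 'a::metric_space \<Rightarrow> 'a) \<Rightarrow> bool" where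
  "li_yorke_chaotic \<delta> f \<longleftrightarrow>
     (\<exists>S. uncountable S \<and> (\<forall>x\<in>S. \<forall>y\<in>S. x \<noteq> y \<longrightarrow>
        liminf (\<lambda>n. ereal (dist (iter f 0 n x) (iter f 0 n y))) = 0 \<and>
        limsup (\<lambda>n. ereal (dist (iter f 0 n x) (iter f 0 n y))) > ereal \<delta>))"

definition close_frequency ::
  "(nat \<Rightarrow> 'a::metric_space \<Rightarrow> 'a) \<Rightarrow> 'a \<Rightarrow> 'a \<Rightarrow> real \<Rightarrow> nat \<Rightarrow> real" where
  "close_frequency f x y \<epsilon> n =
     1 / real n * (\<Sum>i<n. indicator {0..<\<epsilon>} (dist (iter f 0 i x) (iter f 0 i y)))"

definition distributionally_chaotic :: "(nat \<Rightarrow> 'a::metric_space \<Rightarrow> 'a) \<Rightarrow> bool" where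
  "distributionally_chaotic f \<longleftrightarrow>
     (\<exists>D. uncountable D \<and> (\<forall>x\<in>D. \<forall>y\<in>D. x \<noteq> y \<longrightarrow>
        (\<forall>\<epsilon>>0. limsup (\<lambda>n. ereal (close_frequency f x y \<epsilon> n)) = 1) \<and>
        (\<exists>\<delta>>0. liminf (\<lambda>n. ereal (close_frequency f x y \<delta> n)) = 0)))"

end

theory Submission
  imports Defs
begin

text \<open>The nested compact sets \<open>itinerary_set f W \<alpha> m n\<close> shrink to a single point, which defines a map
  from the subshift to \<open>X\<close> for each \<open>n\<close>. Compactness of the subshift makes the shrinking uniform in
  \<open>\<alpha>\<close> and \<open>n\<close>, so these maps are equi-continuous; their inverses are equi-continuous because
  close points have close orbits for a fixed number of steps, while the sets \<open>V i\<close> are separated.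
  Covering by words from above and separating words from below, the entropy is the exponential
  growth rate of the number of admissible words, and \<open>\<parallel>A\<^sup>n\<parallel>\<close> is the number of words of length
  \<open>n + 1\<close>. For chaos, a vertex with two successors lies on two different loops, whose
  concatenations embed a full shift on two symbols; there, an uncountable family of binary
  sequences is chosen in which any two agree on some, and differ everywhere on other, of
  infinitely many blocks \<open>[m!, (m + 1)!)\<close>, each much longer than everything before it.\<close>

section \<open>Subshifts of finite type\<close>

lemma transition_matrix_entry:
  "transition_matrix A \<Longrightarrow> A $ i $ j = 0 \<or> A $ i $ j = 1"
  unfolding transition_matrix_def by auto

lemma transition_matrix_successor:
  assumes "transition_matrix A"
  obtains j where "A $ i $ j = 1"
proof -
  have "(\<Sum>j\<in>UNIV. A $ i $ j) \<noteq> 0"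
    using assms unfolding transition_matrix_def by (metis not_one_le_zero)
  then obtain j where "A $ i $ j \<noteq> 0"
    by (meson sum.neutral)
  then show ?thesis
    using that transition_matrix_entry[OF assms] by metis
qed

lemma transition_matrix_predecessor:
  assumes "transition_matrix A"
  obtains i where "A $ i $ j = 1"
proof -
  have "(\<Sum>i\<in>UNIV. A $ i $ j) \<noteq> 0"
    using assms unfolding transition_matrix_def by (metis not_one_le_zero)
  then obtain i where "A $ i $ j \<noteq> 0"
    by (meson sum.neutral)
  then show ?thesis
    using that transition_matrix_entry[OF assms] by metis
qed

lemma shift_funpow: "(shift ^^ k) s j = s (k + j)"
  by (induction k arbitrary: s j) (simp_all add: shift_def funpow_swap1)

lemma shift_in_subshift: "s \<in> subshift A \<Longrightarrow> shift s \<in> subshift A"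
  by (simp add: subshift_def shift_def)

lemma shift_funpow_in_subshift: "s \<in> subshift A \<Longrightarrow> (shift ^^ k) s \<in> subshift A"
  by (induction k) (simp_all add: shift_in_subshift)

lemma shift_case_nat [simp]: "shift (case_nat i s) = s"
  by (simp add: shift_def)

lemma case_nat_in_subshift:
  "s \<in> subshift A \<Longrightarrow> A $ i $ (s 0) = 1 \<Longrightarrow> case_nat i s \<in> subshift A"
  unfolding subshift_def by (auto split: nat.split)

lemma subshift_exists:
  assumes "transition_matrix A"
  obtains s where "s \<in> subshift A" "s 0 = i"
proof -
  have "\<forall>i. \<exists>j. A $ i $ j = 1"
    using transition_matrix_successor[OF assms] by blast
  then obtain g where g: "A $ i $ g i = 1" for i
    by metis
  show ?thesis
    by (rule that[of "\<lambda>n. (g ^^ n) i"]) (simp_all add: subshift_def g)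
qed

text \<open>By the column condition some symbol may precede \<open>s 0\<close>, and prefixing it
  gives a preimage of \<open>s\<close>. This later makes \<open>f n\<close> map each limit set onto
  the next.\<close>

lemma shift_image_subshift:
  assumes "transition_matrix A"
  shows "shift ` subshift A = subshift A"
proof (intro equalityI subsetI)
  fix s assume s: "s \<in> subshift A"
  obtain i where "A $ i $ (s 0) = 1"
    using transition_matrix_predecessor[OF assms] .
  then show "s \<in> shift ` subshift A"
    using case_nat_in_subshift[OF s] by (metis image_eqI shift_case_nat)
qed (auto simp: shift_in_subshift)

section \<open>The sequence metric and cylinders\<close>

lemma summable_seq_dist:
  "summable (\<lambda>i. (if \<alpha> i = \<beta> i then 0 else 1) / 2 ^ i :: real)"
  by (rule summable_comparison_test'[where g = "\<lambda>i. (1/2) ^ i" and N = 0])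
     (auto simp: power_one_over[symmetric] intro!: summable_geometric)

lemma seq_dist_less_imp_agree:
  assumes "seq_dist \<alpha> \<beta> < 1 / 2 ^ k" and "i \<le> k"
  shows "\<alpha> i = \<beta> i"
proof (rule ccontr)
  assume ne: "\<alpha> i \<noteq> \<beta> i"
  let ?t = "\<lambda>i. (if \<alpha> i = \<beta> i then 0 else 1) / 2 ^ i :: real"
  have "1 / 2 ^ k \<le> (1 / 2 ^ i :: real)"
    using assms(2) by (simp add: field_simps)
  also have "\<dots> = (\<Sum>i\<in>{i}. ?t i)"
    using ne by simp
  also have "\<dots> \<le> seq_dist \<alpha> \<beta>"
    unfolding seq_dist_def by (rule sum_le_suminf[OF summable_seq_dist]) auto
  finally show False
    using assms(1) by simp
qed

lemma seq_dist_le_if_agree: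
  assumes "\<And>i. i < k \<Longrightarrow> \<alpha> i = \<beta> i"
  shows "seq_dist \<alpha> \<beta> \<le> 2 / 2 ^ k"
proof -
  let ?t = "\<lambda>i. (if \<alpha> i = \<beta> i then 0 else 1) / 2 ^ i :: real"
  have "seq_dist \<alpha> \<beta> = (\<Sum>i. ?t (i + k)) + (\<Sum>i<k. ?t i)"
    unfolding seq_dist_def by (rule suminf_split_initial_segment[OF summable_seq_dist])
  also have "(\<Sum>i<k. ?t i) = 0"
    using assms by simp
  also have "(\<Sum>i. ?t (i + k)) \<le> (\<Sum>i. (1/2) ^ i * (1 / 2 ^ k) :: real)"
  proof (rule suminf_le)
    show "?t (i + k) \<le> (1/2) ^ i * (1 / 2 ^ k)" for i
      by (simp add: power_add power_one_over)
    show "summable (\<lambda>i. ?t (i + k))"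
      by (rule summable_ignore_initial_segment[OF summable_seq_dist])
    show "summable (\<lambda>i. (1/2) ^ i * (1 / 2 ^ k) :: real)"
      by (intro summable_mult2 summable_geometric) simp
  qed
  also have "\<dots> = (\<Sum>i. (1/2) ^ i :: real) * (1 / 2 ^ k)"
    by (rule suminf_mult2[symmetric]) (simp add: summable_geometric)
  also have "\<dots> = 2 / 2 ^ k"
    by (simp add: suminf_geometric)
  finally show ?thesis by simp
qed

text \<open>Compactness of the subshift, a closed subset of a product of finite discrete spaces:
  however the lengths \<open>F \<alpha>\<close> are chosen, finitely many cylinders cover it. This
  turns estimates for each \<alpha> into estimates uniform in \<alpha>.\<close>

lemma subshift_finite_cylinder_cover:
  fixes A :: "real^'n^'n" and F :: "(nat \<Rightarrow> 'n) \<Rightarrow> nat"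
  shows "\<exists>M. \<forall>\<beta>\<in>subshift A. \<exists>\<alpha>\<in>subshift A. F \<alpha> \<le> M \<and> (\<forall>k\<le>F \<alpha>. \<beta> k = \<alpha> k)"
proof -
  define T where "T = product_topology (\<lambda>_::nat. discrete_topology (UNIV :: 'n set)) UNIV"
  have top: "topspace T = UNIV"
    by (simp add: T_def)
  have proj: "openin T {s. s j \<in> U}" for j and U :: "'n set"
  proof -
    have "continuous_map T (discrete_topology UNIV) (\<lambda>s. s j)"
      unfolding T_def by (rule continuous_map_product_projection) simp
    from openin_continuous_map_preimage[OF this, of U] show ?thesis
      by (simp add: top)
  qed
  have "compact_space T"
    unfolding T_def compact_space_product_topology by (simp add: compact_space_discrete_topology)
  moreover have "closedin T (subshift A)"
  proof -
    \<comment> \<open>Leaving the subshift is witnessed by one forbidden transition, hence by two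
      adjacent coordinates, so the complement is open.\<close>
    have "openin T ({s. s j \<in> {i}} \<inter> {s. s (Suc j) \<in> {l. A $ i $ l \<noteq> 1}})" for i j
      by (intro openin_Int proj)
    then have "openin T (\<Union>j. \<Union>i. {s. s j \<in> {i}} \<inter> {s. s (Suc j) \<in> {l. A $ i $ l \<noteq> 1}})"
      by blast
    moreover have "topspace T - subshift A = (\<Union>j. \<Union>i. {s. s j \<in> {i}} \<inter> {s. s (Suc j) \<in> {l. A $ i $ l \<noteq> 1}})"
      by (auto simp: subshift_def top)
    ultimately show ?thesis
      by (simp add: closedin_def top)
  qed
  ultimately have comp: "compactin T (subshift A)"
    by (rule closedin_compact_space)
  define C where "C \<alpha> = {\<beta>. \<forall>k\<le>F \<alpha>. \<beta> k = \<alpha> k}" for \<alpha>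
  have "openin T (C \<alpha>)" for \<alpha>
  proof -
    have "C \<alpha> = (\<Inter>k\<in>{..F \<alpha>}. {s. s k \<in> {\<alpha> k}})"
      by (auto simp: C_def)
    moreover have "openin T {s. s k \<in> {\<alpha> k}}" for k
      by (rule proj)
    then have "openin T (\<Inter>k\<in>{..F \<alpha>}. {s. s k \<in> {\<alpha> k}})"
      by (intro openin_Inter) blast+
    ultimately show ?thesis by simp
  qed
  then have "\<And>U. U \<in> C ` subshift A \<Longrightarrow> openin T U"
    by blast
  moreover have "subshift A \<subseteq> \<Union>(C ` subshift A)"
    by (auto simp: C_def)
  ultimately have "\<exists>\<F>. finite \<F> \<and> \<F> \<subseteq> C ` subshift A \<and> subshift A \<subseteq> \<Union>\<F>"
    by (rule compactinD[OF comp])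
  then obtain S where S: "finite S" "S \<subseteq> subshift A" "subshift A \<subseteq> \<Union>(C ` S)"
    by (metis finite_subset_image)
  show ?thesis
  proof (intro exI ballI)
    fix \<beta> assume "\<beta> \<in> subshift A"
    then obtain \<alpha> where "\<alpha> \<in> S" "\<beta> \<in> C \<alpha>"
      using S(3) by blast
    then show "\<exists>\<alpha>\<in>subshift A. F \<alpha> \<le> Max (F ` S) \<and> (\<forall>k\<le>F \<alpha>. \<beta> k = \<alpha> k)"
      using S(1,2) by (auto simp: C_def intro!: bexI[of _ \<alpha>])
  qed
qed

section \<open>Growth of the number of admissible words\<close>

text \<open>Words are prefixes of infinite admissible sequences. For a transition matrix this loses
  no finite word with allowed transitions, since every row contains a one.\<close>

definition admissible_words :: "real^'n^'n \<Rightarrow> nat \<Rightarrow> 'n list set" where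
  "admissible_words A n = (\<lambda>s. map s [0..<n]) ` subshift A"

lemma finite_admissible_words [simp]: "finite (admissible_words (A :: real^'n^'n) n)"
  by (rule finite_subset[OF _ finite_lists_length_eq[of "UNIV :: 'n set" n]])
     (auto simp: admissible_words_def)

lemma card_admissible_words_pos:
  assumes "transition_matrix A"
  shows "card (admissible_words A n) > 0"
proof -
  obtain s where "s \<in> subshift A"
    using subshift_exists[OF assms] by blast
  then show ?thesis
    using finite_admissible_words[of A n] by (auto simp: card_gt_0_iff admissible_words_def)
qed

text \<open>Removing the first symbol \<open>i\<close> leaves a word that starts at a successor of
  \<open>i\<close>, which matches the expansion of row \<open>i\<close> of
  \<open>A ** mat_power A n\<close>. The index is off by one because a path with \<open>n\<close>
  edges has \<open>n + 1\<close> vertices.\<close>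

lemma card_admissible_words_from:
  assumes A: "transition_matrix A"
  shows "real (card ((\<lambda>s. map s [0..<Suc n]) ` {s \<in> subshift A. s 0 = i})) =
         (\<Sum>j\<in>UNIV. mat_power A n $ i $ j)"
proof (induction n arbitrary: i)
  case 0
  obtain s where "s \<in> subshift A" "s 0 = i"
    using subshift_exists[OF A] .
  then have "(\<lambda>s. map s [0..<Suc 0]) ` {s \<in> subshift A. s 0 = i} = {[i]}"
    by auto
  then show ?case
    by (simp add: mat_def)
next
  case (Suc n)
  let ?W = "\<lambda>n i. (\<lambda>s. map s [0..<Suc n]) ` {s \<in> subshift A. s 0 = i}"
  have "?W (Suc n) i = (\<Union>l\<in>{l. A $ i $ l = 1}. (#) i ` ?W n l)"
  proof (intro equalityI subsetI)
    fix w assume "w \<in> ?W (Suc n) i"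
    then obtain s where s: "s \<in> subshift A" "s 0 = i" and w: "w = map s [0..<Suc (Suc n)]"
      by auto
    have "w = i # map (shift s) [0..<Suc n]"
      unfolding w map_upt_Suc by (simp add: shift_def s(2))
    moreover have "A $ i $ s 1 = 1"
      using s by (auto simp: subshift_def)
    moreover have "shift s \<in> subshift A" "shift s 0 = s 1"
      using shift_in_subshift[OF s(1)] by (simp_all add: shift_def)
    ultimately show "w \<in> (\<Union>l\<in>{l. A $ i $ l = 1}. (#) i ` ?W n l)"
      by blast
  next
    fix w assume "w \<in> (\<Union>l\<in>{l. A $ i $ l = 1}. (#) i ` ?W n l)"
    then obtain s where s: "s \<in> subshift A" "A $ i $ s 0 = 1" and w: "w = i # map s [0..<Suc n]"
      by auto
    have "w = map (case_nat i s) [0..<Suc (Suc n)]"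
      unfolding w map_upt_Suc[of _ "Suc n"] by simp
    then show "w \<in> ?W (Suc n) i"
      using case_nat_in_subshift[OF s] by (auto simp del: upt_Suc)
  qed
  moreover have "card (\<Union>l\<in>{l. A $ i $ l = 1}. (#) i ` ?W n l) =
                 (\<Sum>l | A $ i $ l = 1. card ((#) i ` ?W n l))"
  proof (rule card_UN_disjoint)
    show "\<forall>l\<in>{l. A $ i $ l = 1}. finite ((#) i ` ?W n l)"
      by (intro ballI finite_imageI finite_subset[OF _ finite_admissible_words[of A "Suc n"]])
         (auto simp: admissible_words_def)
  qed (auto simp: map_upt_Suc simp del: upt_Suc)
  moreover have "card ((#) i ` ?W n l) = card (?W n l)" for l
    by (rule card_image) simp
  ultimately have "real (card (?W (Suc n) i)) =
      (\<Sum>l | A $ i $ l = 1. \<Sum>j\<in>UNIV. mat_power A n $ l $ j)"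
    using Suc.IH by simp
  also have "\<dots> = (\<Sum>l\<in>UNIV. A $ i $ l * (\<Sum>j\<in>UNIV. mat_power A n $ l $ j))"
    by (rule sum.mono_neutral_cong_left) (use transition_matrix_entry[OF A] in fastforce)+
  also have "\<dots> = (\<Sum>j\<in>UNIV. mat_power A (Suc n) $ i $ j)"
    by (simp add: matrix_matrix_mult_def sum_distrib_left) (rule sum.swap)
  finally show ?case .
qed

lemma card_admissible_words:
  assumes A: "transition_matrix A"
  shows "real (card (admissible_words A (Suc n))) = entry_sum (mat_power A n)"
proof -
  let ?W = "\<lambda>i. (\<lambda>s. map s [0..<Suc n]) ` {s \<in> subshift A. s 0 = i}"
  have "admissible_words A (Suc n) = (\<Union>i. ?W i)"
    by (auto simp: admissible_words_def)
  moreover have "card (\<Union>i. ?W i) = (\<Sum>i\<in>UNIV. card (?W i))"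
  proof (rule card_UN_disjoint)
    show "\<forall>i\<in>UNIV. finite (?W i)"
      by (intro ballI finite_subset[OF _ finite_admissible_words[of A "Suc n"]])
         (auto simp: admissible_words_def)
  qed (auto simp: map_upt_Suc simp del: upt_Suc)
  ultimately show ?thesis
    by (simp add: entry_sum_def card_admissible_words_from[OF A] del: upt_Suc)
qed

text \<open>Cutting a word after \<open>m\<close> symbols is injective, and the rest is a prefix of
  a shifted sequence. The logarithms thus become subadditive, as Fekete's lemma requires.\<close>

lemma card_admissible_words_add:
  "card (admissible_words A (m + n)) \<le> card (admissible_words A m) * card (admissible_words A n)"
proof -
  let ?g = "\<lambda>w. (take m w, drop m w)"
  have "?g ` admissible_words A (m + n) \<subseteq> admissible_words A m \<times> admissible_words A n"
  proof (safe, goal_cases)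
    case (1 w1 w2 w)
    then show ?case
      by (auto simp: admissible_words_def take_map)
  next
    case (2 w1 w2 w)
    then obtain s where s: "s \<in> subshift A" "w = map s [0..<m + n]"
      by (auto simp: admissible_words_def)
    have "drop m w = map ((shift ^^ m) s) [0..<n]"
      by (rule nth_equalityI) (auto simp: s shift_funpow)
    then show ?case
      using shift_funpow_in_subshift[OF s(1)] by (auto simp: admissible_words_def)
  qed
  moreover have "inj_on ?g (admissible_words A (m + n))"
    by (rule inj_onI) (metis append_take_drop_id prod.inject)
  ultimately have "card (admissible_words A (m + n)) \<le> card (admissible_words A m \<times> admissible_words A n)"
    by (intro card_inj_on_le) auto
  then show ?thesis
    by (simp add: card_cartesian_product)
qed

text \<open>Fekete's lemma, with the infimum \<open>l\<close> as the limit: dividing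
  \<open>n\<close> by \<open>k\<close> with remainder bounds \<open>a n / n\<close> by
  \<open>a k / k\<close> plus a term that vanishes as \<open>n\<close> grows.\<close>

lemma fekete_subadditive_convergent:
  fixes a :: "nat \<Rightarrow> real"
  assumes sub: "\<And>m n. a (m + n) \<le> a m + a n" and nonneg: "\<And>n. a n \<ge> 0"
  shows "convergent (\<lambda>n. a n / n)"
proof -
  define l where "l = (INF n\<in>{0<..}. a n / real n)"
  have bdd: "bdd_below ((\<lambda>n. a n / real n) ` {0<..})"
    by (rule bdd_belowI[where m = 0]) (auto simp: nonneg)
  have mult: "a (q * k) \<le> q * a k" if "q > 0" for q k
    using that
  proof (induction q rule: nat_induct_non_zero)
    case (Suc q)
    then show ?case
      using sub[of k "q * k"] by (simp add: algebra_simps)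
  qed simp
  have "(\<lambda>n. a n / n) \<longlonglongrightarrow> l"
  proof (rule LIMSEQ_I)
    fix e :: real assume e: "e > 0"
    have "\<exists>k\<in>{0<..}. a k / real k < l + e / 2"
      using e cINF_less_iff[OF _ bdd, of "l + e / 2"] by (auto simp: l_def)
    then obtain k where k: "k > 0" "a k / real k < l + e / 2"
      by auto
    \<comment> \<open>\<open>B\<close> bounds \<open>a\<close> on all remainders modulo
      \<open>k\<close>; for \<open>n\<close> beyond \<open>2 * B / e\<close> its share
      \<open>B / n\<close> is below \<open>e / 2\<close>.\<close>
    define B where "B = Max (a ` {..<k})"
    have B: "a r \<le> B" if "r < k" for r
      unfolding B_def using that by simp
    have B0: "B \<ge> 0"
      using B[OF k(1)] nonneg[of 0] by linarith
    obtain N :: nat where N: "N > 2 * B / e"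
      using reals_Archimedean2 by blast
    show "\<exists>no. \<forall>n\<ge>no. norm (a n / n - l) < e"
    proof (intro exI allI impI)
      fix n assume n: "n \<ge> Suc (N + k)"
      have "n div k > 0"
        using n k by (simp add: div_greater_zero_iff)
      have "a n = a ((n div k) * k + n mod k)"
        by simp
      also have "\<dots> \<le> a ((n div k) * k) + a (n mod k)"
        by (rule sub)
      also have "\<dots> \<le> (n div k) * a k + B"
        using mult[OF \<open>n div k > 0\<close>, of k] B[of "n mod k"] k by simp
      also have "(n div k) * a k = real ((n div k) * k) * (a k / k)"
        using k by simp
      also have "\<dots> \<le> real n * (a k / k)"
        by (intro mult_right_mono) (use nonneg[of k] in \<open>simp_all add: div_times_less_eq_dividend del: of_nat_mult\<close>)
      finally have "a n / n \<le> a k / k + B / n"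
        using n by (simp add: field_simps)
      also have "B / n < e / 2"
      proof -
        have "2 * B < N * e"
          using N e by (simp add: field_simps)
        also have "\<dots> \<le> n * e"
          using n e by (intro mult_right_mono) auto
        finally show ?thesis
          using n by (simp add: field_simps)
      qed
      finally have "a n / n < l + e"
        using k by simp
      moreover have "l \<le> a n / n"
        unfolding l_def by (rule cINF_lower[OF bdd]) (use n in auto)
      ultimately show "norm (a n / n - l) < e"
        using e by simp
    qed
  qed
  then show ?thesis
    by (rule convergentI)
qed

text \<open>A fixed offset \<open>k\<close> does not change the growth rate. It is kept free because
  the entropy bounds use the offsets 0 and \<open>Suc m\<close>, while the entries of
  \<open>mat_power A n\<close> count words of length \<open>n + 1\<close>.\<close>

lemma ln_card_admissible_words_tendsto:
  assumes A: "transition_matrix A"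
  shows "(\<lambda>n. ln (card (admissible_words A (n + k))) / n) \<longlonglongrightarrow> ln (matrix_rho A)"
proof -
  define c where "c n = card (admissible_words A n)" for n
  have c: "c n > 0" for n
    unfolding c_def by (rule card_admissible_words_pos[OF A])
  have "convergent (\<lambda>n. ln (c n) / n)"
  proof (rule fekete_subadditive_convergent)
    fix m n
    have "real (c (m + n)) \<le> c m * c n"
      unfolding c_def of_nat_mult[symmetric] of_nat_le_iff by (rule card_admissible_words_add)
    then have "ln (c (m + n)) \<le> ln (real (c m) * c n)"
      using c by (subst ln_le_cancel_iff) auto
    then show "ln (c (m + n)) \<le> ln (c m) + ln (c n)"
      using c[of m] c[of n] by (simp add: ln_mult)
  next
    show "ln (real (c n)) \<ge> 0" for n
      using c[of n] by (intro ln_ge_zero) linarith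
  qed
  then obtain l where l: "(\<lambda>n. ln (c n) / n) \<longlonglongrightarrow> l"
    by (auto simp: convergent_def)
  have lim: "(\<lambda>n. ln (c (n + k)) / n) \<longlonglongrightarrow> l" for k
  proof -
    have "(\<lambda>n. ln (c (n + k)) / (n + k) * ((n + k) / n)) \<longlonglongrightarrow> l * 1"
    proof (rule tendsto_mult)
      show "(\<lambda>n. ln (c (n + k)) / (n + k)) \<longlonglongrightarrow> l"
        using LIMSEQ_ignore_initial_segment[OF l, of k] by simp
      show "(\<lambda>n. real (n + k) / n) \<longlonglongrightarrow> 1"
      proof (rule Lim_transform_eventually)
        show "(\<lambda>n. 1 + real k / n) \<longlonglongrightarrow> 1"
          using tendsto_add[OF tendsto_const lim_const_over_n] by fastforce
        show "\<forall>\<^sub>F n in sequentially. 1 + real k / n = real (n + k) / n"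
          using eventually_gt_at_top[of 0] by eventually_elim (simp add: field_simps)
      qed
    qed
    moreover have "\<forall>\<^sub>F n in sequentially. ln (c (n + k)) / (n + k) * ((n + k) / n) = ln (c (n + k)) / n"
      using eventually_gt_at_top[of 0] by eventually_elim auto
    ultimately show ?thesis
      unfolding mult_1_right by (rule Lim_transform_eventually)
  qed
  \<comment> \<open>With offset 1 the exponential is the n-th root of the entry sum, so the limit
    defining \<open>matrix_rho A\<close> exists and equals \<open>exp l\<close>.\<close>
  have "(\<lambda>n. exp (ln (c (n + 1)) / n)) \<longlonglongrightarrow> exp l"
    by (intro tendsto_exp lim)
  moreover have "\<forall>\<^sub>F n in sequentially. exp (ln (c (n + 1)) / n) = root n (entry_sum (mat_power A n))"
    using eventually_gt_at_top[of 0]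
  proof eventually_elim
    case (elim n)
    then show ?case
      using c[of "n + 1"] card_admissible_words[OF A, of n]
      by (simp add: c_def root_powr_inverse powr_def divide_inverse mult.commute)
  qed
  ultimately have "(\<lambda>n. root n (entry_sum (mat_power A n))) \<longlonglongrightarrow> exp l"
    by (rule Lim_transform_eventually)
  then have "matrix_rho A = exp l"
    unfolding matrix_rho_def by (rule limI)
  then show ?thesis
    using lim[of k] by (simp add: c_def)
qed

section \<open>Free concatenations of two loops\<close>

text \<open>A positive entry of a product has a positive summand, which supplies the first edge. The
  walk omits its end \<open>j\<close>, so that walks can be joined by appending lists.\<close>

lemma mat_power_pos_imp_walk:
  assumes A: "transition_matrix A"
  shows "mat_power A (Suc k) $ i $ j > 0 \<Longrightarrow>
    \<exists>w. w \<noteq> [] \<and> hd w = i \<and> successively (\<lambda>a b. A $ a $ b = 1) w \<and> A $ last w $ j = 1"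
proof (induction k arbitrary: i)
  case 0
  then show ?case
    using transition_matrix_entry[OF A, of i j] by (intro exI[of _ "[i]"]) auto
next
  case (Suc k)
  have "(\<Sum>l\<in>UNIV. A $ i $ l * mat_power A (Suc k) $ l $ j) > 0"
    using Suc.prems by (simp only: mat_power.simps(2)[of A "Suc k"] matrix_matrix_mult_def vec_lambda_beta)
  then have "\<exists>l. A $ i $ l * mat_power A (Suc k) $ l $ j > 0"
    by (meson not_less sum_nonpos)
  then obtain l where l: "A $ i $ l * mat_power A (Suc k) $ l $ j > 0"
    by blast
  then have "A $ i $ l = 1" "mat_power A (Suc k) $ l $ j > 0"
    using transition_matrix_entry[OF A, of i l] by auto
  with Suc.IH obtain w where "w \<noteq> []" "hd w = l" "successively (\<lambda>a b. A $ a $ b = 1) w" "A $ last w $ j = 1"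
    by blast
  with \<open>A $ i $ l = 1\<close> show ?case
    by (intro exI[of _ "i # w"]) (auto simp: successively_Cons)
qed

text \<open>Both words are loops at the vertex \<open>hd u\<close>, with the final return left out.
  Equal lengths allow division by \<open>length u\<close> to locate the current loop, and index 1
  tells the two loops apart.\<close>

definition loop_pair :: "real^'n^'n \<Rightarrow> 'n list \<Rightarrow> 'n list \<Rightarrow> bool" where
  "loop_pair A u v \<longleftrightarrow> length u = length v \<and> 2 \<le> length u \<and> hd u = hd v \<and> u ! 1 \<noteq> v ! 1 \<and>
     (\<forall>w\<in>{u, v}. successively (\<lambda>a b. A $ a $ b = 1) w \<and> A $ last w $ hd u = 1)"

text \<open>Two loops through a branching vertex get the same length by concatenating them in both orders.\<close>
lemma loop_pair_exists:
  assumes A: "transition_matrix A" and irr: "irreducible_matrix A"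
    and row: "(\<Sum>j\<in>UNIV. A $ i $ j) \<ge> 2"
  shows "\<exists>u v. loop_pair A u v"
proof -
  have "\<exists>a b. a \<noteq> b \<and> A $ i $ a = 1 \<and> A $ i $ b = 1"
  proof (rule ccontr)
    assume *: "\<not> ?thesis"
    obtain a where a: "A $ i $ a = 1"
      using transition_matrix_successor[OF A] .
    then have "A $ i $ j = (if j = a then 1 else 0)" for j
      using * transition_matrix_entry[OF A, of i j] by auto
    then show False
      using row by simp
  qed
  then obtain a b where ab: "a \<noteq> b" "A $ i $ a = 1" "A $ i $ b = 1"
    by blast
  have "\<exists>w. w \<noteq> [] \<and> hd w = c \<and> successively (\<lambda>a b. A $ a $ b = 1) w \<and> A $ last w $ i = 1" for c
  proof -
    obtain k where "k \<ge> 1" "mat_power A k $ c $ i > 0"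
      using irr unfolding irreducible_matrix_def by blast
    then show ?thesis
      using mat_power_pos_imp_walk[OF A, of "k - 1" c i] by simp
  qed
  then obtain p where p: "p c \<noteq> []" "hd (p c) = c" "successively (\<lambda>a b. A $ a $ b = 1) (p c)"
      "A $ last (p c) $ i = 1" for c
    by metis
  have hd: "(p c @ xs) ! 0 = c" for c xs
    using p(1,2)[of c] by (cases "p c") auto
  \<comment> \<open>The second symbols are \<open>a\<close> and \<open>b\<close>, so the two words
    differ at index 1.\<close>
  let ?u = "(i # p a) @ (i # p b)" and ?v = "(i # p b) @ (i # p a)"
  have "successively (\<lambda>a b. A $ a $ b = 1) ?u" "successively (\<lambda>a b. A $ a $ b = 1) ?v"
    using p ab by (auto simp: successively_append_iff successively_Cons)
  then have "loop_pair A ?u ?v"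
    using p ab(1) hd by (auto simp: loop_pair_def)
  then show ?thesis
    by blast
qed

definition loop_concat :: "'n list \<Rightarrow> 'n list \<Rightarrow> nat set \<Rightarrow> nat \<Rightarrow> 'n" where
  "loop_concat u v B n = (if n div length u \<in> B then u else v) ! (n mod length u)"

text \<open>Each transition is either inside a loop or from the end of a loop to
  \<open>hd u\<close>. Both loops begin with \<open>hd u\<close>, so it does not matter which one
  follows.\<close>

lemma loop_concat_in_subshift:
  assumes "loop_pair A u v"
  shows "loop_concat u v B \<in> subshift A"
  unfolding subshift_def
proof (intro CollectI allI)
  fix n
  let ?L = "length u" and ?w = "\<lambda>k. if k \<in> B then u else v"
  have L: "?L \<ge> 2" and len: "length (?w k) = ?L" and hd: "?w k ! 0 = hd u" for k
    using assms hd_conv_nth[of u] hd_conv_nth[of v]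
    by (cases "u = []"; cases "v = []"; auto simp: loop_pair_def)+
  have w: "successively (\<lambda>a b. A $ a $ b = 1) (?w k)" "A $ last (?w k) $ hd u = 1" for k
    using assms by (auto simp: loop_pair_def)
  show "A $ loop_concat u v B n $ loop_concat u v B (Suc n) = 1"
  proof (cases "Suc (n mod ?L) = ?L")
    case True
    then have "Suc n mod ?L = 0" "Suc n div ?L = Suc (n div ?L)"
      by (simp_all add: mod_Suc div_Suc)
    moreover have "?w k ! (n mod ?L) = last (?w k)" for k
    proof -
      have "n mod ?L = length (?w k) - 1" "?w k \<noteq> []"
        using True L len[of k] by auto
      then show ?thesis
        by (metis last_conv_nth)
    qed
    ultimately show ?thesis
      using w(2) hd unfolding loop_concat_def by simp
  next
    case False
    moreover have "n mod ?L < ?L"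
      by (rule mod_less_divisor) (use L in linarith)
    ultimately have "Suc n mod ?L = Suc (n mod ?L)" "Suc n div ?L = n div ?L" "Suc (n mod ?L) < ?L"
      by (simp_all add: mod_Suc div_Suc)
    then show ?thesis
      using w(1)[of "n div ?L"] len[of "n div ?L"]
      unfolding loop_concat_def successively_conv_nth by simp
  qed
qed

lemma loop_concat_eq:
  "(n div length u \<in> B \<longleftrightarrow> n div length u \<in> C) \<Longrightarrow> loop_concat u v B n = loop_concat u v C n"
  by (simp add: loop_concat_def)

text \<open>Position \<open>k * length u + 1\<close> is index 1 of loop number \<open>k\<close>, the
  place where \<open>u\<close> and \<open>v\<close> differ.\<close>

lemma loop_concat_neq:
  assumes "loop_pair A u v" "k \<in> B \<longleftrightarrow> k \<notin> C"
  shows "loop_concat u v B (k * length u + 1) \<noteq> loop_concat u v C (k * length u + 1)"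
proof -
  define n where "n = k * length u + 1"
  have uv: "1 < length u" "u ! 1 \<noteq> v ! 1"
    using assms(1) by (auto simp: loop_pair_def)
  have "n div length u = k"
    unfolding n_def using uv(1) by (intro div_nat_eqI) auto
  moreover have "n mod length u = n - n div length u * length u"
    by (simp add: minus_div_mult_eq_mod)
  ultimately have "n div length u = k" "n mod length u = 1"
    by (simp_all add: n_def)
  then show ?thesis
    using assms(2) uv(2) unfolding n_def[symmetric] loop_concat_def by auto
qed

section \<open>Factorial blocks\<close>

text \<open>On the block of the integers between \<open>m!\<close> and \<open>(m + 1)!\<close> the set is empty if \<open>m\<close> is even,
  and records membership of \<open>i\<close> in \<open>X\<close> if \<open>m = 2 * prod_encode (i, j) + 1\<close>. Thus any two such
  sets agree on infinitely many blocks, and are complementary on infinitely many blocks if they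
  come from different \<open>X\<close>.\<close>
definition block_set :: "nat set \<Rightarrow> nat set" where
  "block_set X = {k. \<exists>i\<in>X. \<exists>j. fact (2 * prod_encode (i, j) + 1) \<le> k \<and> k < fact (2 * prod_encode (i, j) + 2)}"

lemma fact_block_unique:
  fixes k m p :: nat
  assumes "fact m \<le> k" "k < fact (Suc m)" "fact p \<le> k" "k < fact (Suc p)"
  shows "m = p"
proof (rule ccontr)
  assume "m \<noteq> p"
  then consider "Suc m \<le> p" | "Suc p \<le> m"
    by linarith
  then show False
    using assms fact_mono_nat[of "Suc m" p] fact_mono_nat[of "Suc p" m] by cases linarith+
qed

lemma block_sets_agree:
  "\<exists>m\<ge>M. \<forall>k. fact m \<le> k \<and> k < fact (Suc m) \<longrightarrow> (k \<in> block_set X \<longleftrightarrow> k \<in> block_set Y)"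
proof -
  have "k \<notin> block_set Z" if k: "fact (2 * M) \<le> k" "k < fact (Suc (2 * M))" for k Z
  proof
    assume "k \<in> block_set Z"
    then obtain q where "fact (2 * q + 1) \<le> k" "k < fact (Suc (2 * q + 1))"
      by (auto simp: block_set_def simp del: fact_Suc)
    \<comment> \<open>Uniqueness of the block would equate the even number \<open>2 * M\<close> with
      an odd one.\<close>
    from fact_block_unique[OF k this] show False
      by presburger
  qed
  then show ?thesis
    by (intro exI[of _ "2 * M"]) auto
qed

lemma block_sets_complementary:
  assumes "X \<noteq> Y"
  shows "\<exists>m\<ge>M. \<forall>k. fact m \<le> k \<and> k < fact (Suc m) \<longrightarrow> (k \<in> block_set X \<longleftrightarrow> k \<notin> block_set Y)"
proof -
  obtain i where i: "i \<in> X \<longleftrightarrow> i \<notin> Y"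
    using assms by blast
  \<comment> \<open>The second component of the pair is free; taking \<open>M\<close> pushes the
    block index above \<open>M\<close>.\<close>
  define m where "m = 2 * prod_encode (i, M) + 1"
  have "k \<in> block_set Z \<longleftrightarrow> i \<in> Z" if k: "fact m \<le> k" "k < fact (Suc m)" for k Z
  proof
    assume "k \<in> block_set Z"
    then obtain a j where a: "a \<in> Z" "fact (2 * prod_encode (a, j) + 1) \<le> k"
        "k < fact (Suc (2 * prod_encode (a, j) + 1))"
      by (auto simp: block_set_def simp del: fact_Suc)
    have "m = 2 * prod_encode (a, j) + 1"
      using fact_block_unique[OF k a(2,3)] .
    then show "i \<in> Z"
      using a(1) by (simp add: m_def)
  next
    assume "i \<in> Z"
    then show "k \<in> block_set Z"
      using k unfolding block_set_def m_def by (auto simp del: fact_Suc)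
  qed
  moreover have "m \<ge> M"
    using le_prod_encode_2[of M i] by (simp add: m_def)
  ultimately show ?thesis
    using i by blast
qed

section \<open>Averages along long blocks\<close>

text \<open>At time \<open>L * m * fact m\<close> the part before the block is only the fraction
  \<open>1 / m\<close> of the whole, and each of its terms deviates from \<open>c\<close> by at most
  1.\<close>

lemma average_block_end:
  fixes g :: "nat \<Rightarrow> real" and c :: real
  assumes "L > 0" "m > 0" and g: "\<And>i. 0 \<le> g i" "\<And>i. g i \<le> 1" and c: "0 \<le> c" "c \<le> 1"
    and block: "\<And>i. L * fact m \<le> i \<Longrightarrow> i < L * m * fact m \<Longrightarrow> g i = c"
  shows "\<bar>1 / real (L * m * fact m) * (\<Sum>i<L * m * fact m. g i) - c\<bar> \<le> 1 / m"
proof -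
  define n where "n = L * m * fact m"
  have n: "n > 0"
    using assms(1,2) by (simp add: n_def)
  have le: "L * fact m \<le> n"
    using assms(2) by (simp add: n_def)
  have "\<bar>\<Sum>i<n. g i - c\<bar> \<le> (\<Sum>i<n. \<bar>g i - c\<bar>)"
    by (rule sum_abs)
  also have "\<dots> = (\<Sum>i<L * fact m. \<bar>g i - c\<bar>)"
    using le block by (intro sum.mono_neutral_right) (auto simp: n_def)
  also have "\<dots> \<le> of_nat (card {..<L * fact m}) * 1"
    using g c by (intro sum_bounded_above) (simp add: abs_le_iff add_increasing2 algebra_simps)
  finally have "\<bar>(\<Sum>i<n. g i) - n * c\<bar> \<le> real (L * fact m)"
    by (simp add: sum_subtractf)
  then have "\<bar>(\<Sum>i<n. g i) - n * c\<bar> / n \<le> real (L * fact m) / n"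
    by (intro divide_right_mono) auto
  also have "\<bar>(\<Sum>i<n. g i) - n * c\<bar> / n = \<bar>((\<Sum>i<n. g i) - n * c) / n\<bar>"
    by simp
  also have "((\<Sum>i<n. g i) - n * c) / n = 1 / real n * (\<Sum>i<n. g i) - c"
    using n by (simp add: field_simps)
  also have "real (L * fact m) / n = 1 / m"
    using assms(1) by (simp add: n_def)
  finally show ?thesis
    by (simp add: n_def)
qed

lemma average_frequently_near:
  fixes g :: "nat \<Rightarrow> real" and c e :: real
  assumes L: "L > 0" and g: "\<And>i. 0 \<le> g i" "\<And>i. g i \<le> 1" and c: "0 \<le> c" "c \<le> 1"
    and block: "\<And>M. \<exists>m\<ge>M. \<forall>i. L * fact m \<le> i \<and> i < L * m * fact m \<longrightarrow> g i = c"
    and e: "e > 0"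
  shows "\<exists>n\<ge>N. \<bar>1 / real n * (\<Sum>i<n. g i) - c\<bar> < e"
proof -
  obtain K where K: "inverse (real (Suc K)) < e"
    using reals_Archimedean[OF e] by blast
  \<comment> \<open>One choice meets both demands: \<open>1 / m\<close> is below \<open>e\<close>,
    and the block ends beyond \<open>N\<close>.\<close>
  obtain m where m: "m \<ge> Suc (N + K)"
    and g1: "\<And>i. L * fact m \<le> i \<Longrightarrow> i < L * m * fact m \<Longrightarrow> g i = c"
    using block by blast
  have "\<bar>1 / real (L * m * fact m) * (\<Sum>i<L * m * fact m. g i) - c\<bar> \<le> 1 / m"
    using m by (intro average_block_end[OF L _ g c g1]) auto
  also have "\<dots> \<le> inverse (real (Suc K))"
    using m by (simp add: field_simps)
  finally have "\<bar>1 / real (L * m * fact m) * (\<Sum>i<L * m * fact m. g i) - c\<bar> < e"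
    using K by simp
  moreover have "N * 1 \<le> m * (L * fact m)"
    using m L by (intro mult_le_mono) (auto simp: Suc_le_eq)
  ultimately show ?thesis
    by (intro exI[of _ "L * m * fact m"]) (simp add: mult_ac)
qed

lemma average_bounds:
  fixes g :: "nat \<Rightarrow> real"
  assumes g: "\<And>i. 0 \<le> g i" "\<And>i. g i \<le> 1"
  shows "0 \<le> 1 / real n * (\<Sum>i<n. g i)" "1 / real n * (\<Sum>i<n. g i) \<le> 1"
proof -
  have "(\<Sum>i<n. g i) \<le> of_nat (card {..<n}) * 1"
    by (rule sum_bounded_above) (rule g)
  then show "1 / real n * (\<Sum>i<n. g i) \<le> 1"
    by (cases "n = 0") (simp_all add: field_simps)
qed (simp add: sum_nonneg g)

text \<open>Averages stay below or at 1 and return arbitrarily close to 1, so no \<open>y\<close>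
  below 1 is an eventual bound.\<close>

lemma limsup_average_eq_1:
  fixes g :: "nat \<Rightarrow> real"
  assumes L: "L > 0" and g: "\<And>i. 0 \<le> g i" "\<And>i. g i \<le> 1"
    and block: "\<And>M. \<exists>m\<ge>M. \<forall>i. L * fact m \<le> i \<and> i < L * m * fact m \<longrightarrow> g i = 1"
  shows "limsup (\<lambda>n. ereal (1 / real n * (\<Sum>i<n. g i))) = 1"
proof (rule antisym)
  show "limsup (\<lambda>n. ereal (1 / real n * (\<Sum>i<n. g i))) \<le> 1"
    by (intro Limsup_bounded always_eventually allI) (use average_bounds[of g, OF g] in simp)
  show "1 \<le> limsup (\<lambda>n. ereal (1 / real n * (\<Sum>i<n. g i)))"
  proof (rule ccontr)
    assume "\<not> ?thesis"
    then obtain y where y: "limsup (\<lambda>n. ereal (1 / real n * (\<Sum>i<n. g i))) < ereal y" "ereal y < 1"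
      unfolding not_le using ereal_dense2 by blast
    from Limsup_lessD[OF y(1)] obtain N
      where N: "\<And>n. n \<ge> N \<Longrightarrow> 1 / real n * (\<Sum>i<n. g i) < y"
      by (auto simp: eventually_sequentially)
    have "0 < 1 - y"
      using y(2) by simp
    with average_frequently_near[where c = 1, OF L g _ _ block] obtain n
      where "n \<ge> N" "\<bar>1 / real n * (\<Sum>i<n. g i) - 1\<bar> < 1 - y"
      by (metis order_refl zero_le_one)
    with N[of n] show False
      by linarith
  qed
qed

lemma liminf_average_eq_0:
  fixes g :: "nat \<Rightarrow> real"
  assumes L: "L > 0" and g: "\<And>i. 0 \<le> g i" "\<And>i. g i \<le> 1"
    and block: "\<And>M. \<exists>m\<ge>M. \<forall>i. L * fact m \<le> i \<and> i < L * m * fact m \<longrightarrow> g i = 0"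
  shows "liminf (\<lambda>n. ereal (1 / real n * (\<Sum>i<n. g i))) = 0"
proof (rule antisym)
  show "0 \<le> liminf (\<lambda>n. ereal (1 / real n * (\<Sum>i<n. g i)))"
    by (intro Liminf_bounded always_eventually allI) (use average_bounds[of g, OF g] in simp)
  show "liminf (\<lambda>n. ereal (1 / real n * (\<Sum>i<n. g i))) \<le> 0"
  proof (rule ccontr)
    assume "\<not> ?thesis"
    then obtain y where y: "ereal y < liminf (\<lambda>n. ereal (1 / real n * (\<Sum>i<n. g i)))" "0 < ereal y"
      unfolding not_le using ereal_dense2 by blast
    from less_LiminfD[OF y(1)] obtain N
      where N: "\<And>n. n \<ge> N \<Longrightarrow> y < 1 / real n * (\<Sum>i<n. g i)"
      by (auto simp: eventually_sequentially)
    have "0 < y"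
      using y(2) by simp
    with average_frequently_near[where c = 0, OF L g _ _ block] obtain n
      where "n \<ge> N" "\<bar>1 / real n * (\<Sum>i<n. g i) - 0\<bar> < y"
      by (metis order_refl zero_le_one)
    with N[of n] show False
      by linarith
  qed
qed

section \<open>Coding by itineraries\<close>

lemma iter_add: "iter f n (j + k) x = iter f (n + j) k (iter f n j x)"
  by (induction k) (simp_all add: add.assoc)

lemma iter_Suc_left: "iter f n (Suc k) x = iter f (Suc n) k (f n x)"
  using iter_add[of f n 1 k x] by simp

lemma itinerary_set_iff:
  "x \<in> itinerary_set f W \<alpha> m n \<longleftrightarrow> (\<forall>k\<le>m. iter f n k x \<in> W (\<alpha> k) (n + k))"
  by (auto simp: itinerary_set_def)

lemma itinerary_set_Suc:
  "itinerary_set f W \<alpha> (Suc m) n = W (\<alpha> 0) n \<inter> f n -` itinerary_set f W (shift \<alpha>) m (Suc n)"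
proof (rule set_eqI)
  fix x
  let ?P = "\<lambda>k. iter f n k x \<in> W (\<alpha> k) (n + k)"
  have "(\<forall>k\<le>Suc m. ?P k) \<longleftrightarrow> ?P 0 \<and> (\<forall>k\<le>m. ?P (Suc k))"
    using All_less_Suc2[of "Suc m" ?P] by (simp only: less_Suc_eq_le)
  then show "x \<in> itinerary_set f W \<alpha> (Suc m) n \<longleftrightarrow>
      x \<in> W (\<alpha> 0) n \<inter> f n -` itinerary_set f W (shift \<alpha>) m (Suc n)"
    unfolding itinerary_set_iff Int_iff vimage_eq iter_Suc_left shift_def by simp
qed

lemma itinerary_set_antimono:
  "m \<le> m' \<Longrightarrow> itinerary_set f W \<alpha> m' n \<subseteq> itinerary_set f W \<alpha> m n"
  by (auto simp: itinerary_set_iff)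

lemma itinerary_set_cong:
  "(\<And>k. k \<le> m \<Longrightarrow> \<alpha> k = \<beta> k) \<Longrightarrow> itinerary_set f W \<alpha> m n = itinerary_set f W \<beta> m n"
  by (simp add: itinerary_set_def)

section \<open>Standing hypotheses; separation and equi-continuity along orbits\<close>

locale itinerary_system =
  fixes f :: "nat \<Rightarrow> 'a::metric_space \<Rightarrow> 'a"
    and A :: "real^'n^'n"
    and V :: "'n \<Rightarrow> 'a set"
    and W :: "'n \<Rightarrow> nat \<Rightarrow> 'a set"
  assumes transition: "transition_matrix A"
    and setdist_pos: "\<And>i j. i \<noteq> j \<Longrightarrow> setdist (V i) (V j) > 0"
    and compact_W: "\<And>i n. compact (W i n)"
    and W_subset_V: "\<And>i n. W i n \<subseteq> V i"
    and equi_continuous: "equi_continuous_on dist dist (\<lambda>_. \<Union>n. \<Union>i. W i n) f"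
    and itinerary_set_nonempty: "\<And>\<alpha> m n. \<alpha> \<in> subshift A \<Longrightarrow> itinerary_set f W \<alpha> m n \<noteq> {}"
    and diameter_itinerary_set: "\<And>\<alpha>. \<alpha> \<in> subshift A \<Longrightarrow>
           uniform_limit UNIV (\<lambda>m n. diameter (itinerary_set f W \<alpha> m n)) (\<lambda>_. 0) sequentially"
begin

text \<open>Finitely many pairs of symbols give a positive minimal distance, and it serves all times
  at once because \<open>W i n\<close> lies in \<open>V i\<close>.\<close>

lemma separation:
  obtains \<eta> where "\<eta> > 0" "\<And>i j x y n m. x \<in> W i n \<Longrightarrow> y \<in> W j m \<Longrightarrow> dist x y < \<eta> \<Longrightarrow> i = j"
proof -
  define S where "S = insert 1 ((\<lambda>(i, j). setdist (V i) (V j)) ` {(i, j). i \<noteq> j})"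
  have S: "finite S" "S \<noteq> {}"
    by (auto simp: S_def)
  show ?thesis
  proof
    show "Min S > 0"
      using S by (auto simp: S_def setdist_pos)
    fix i j x y n m
    assume xy: "x \<in> W i n" "y \<in> W j m" "dist x y < Min S"
    show "i = j"
    proof (rule ccontr)
      assume "i \<noteq> j"
      then have "Min S \<le> setdist (V i) (V j)"
        using S by (intro Min_le) (auto simp: S_def)
      also have "\<dots> \<le> dist x y"
        using xy W_subset_V by (intro setdist_le_dist) blast+
      finally show False
        using xy(3) by simp
    qed
  qed
qed

lemma W_inj: "x \<in> W i n \<Longrightarrow> x \<in> W j m \<Longrightarrow> i = j"
  by (rule separation) (metis dist_self)

lemma continuous_on_W: "continuous_on (W i n) (f n)"
  unfolding continuous_on_iff
proof (intro ballI allI impI)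
  fix x e assume x: "x \<in> W i n" and e: "(e :: real) > 0"
  obtain d where "d > 0" and d: "\<And>n x y. x \<in> (\<Union>n. \<Union>i. W i n) \<Longrightarrow> y \<in> (\<Union>n. \<Union>i. W i n) \<Longrightarrow>
      dist x y < d \<Longrightarrow> dist (f n x) (f n y) < e"
    using equi_continuous e unfolding equi_continuous_on_def by meson
  show "\<exists>d>0. \<forall>x'\<in>W i n. dist x' x < d \<longrightarrow> dist (f n x') (f n x) < e"
    using x \<open>d > 0\<close> by (intro exI[of _ d]) (auto intro!: d)
qed

text \<open>Equi-continuity is given only on the union of the \<open>W i n\<close>, so it can be
  iterated only along orbits that remain there.\<close>

definition tracked :: "nat \<Rightarrow> 'a \<Rightarrow> bool" where
  "tracked n x \<longleftrightarrow> (\<forall>k. iter f n k x \<in> (\<Union>n. \<Union>i. W i n))"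

lemma iter_equi_continuous:
  assumes "e > 0"
  shows "\<exists>d>0. \<forall>n x y k. tracked n x \<longrightarrow> tracked n y \<longrightarrow> dist x y < d \<longrightarrow> k \<le> K \<longrightarrow>
           dist (iter f n k x) (iter f n k y) < e"
  using assms
proof (induction K arbitrary: e)
  case 0
  then show ?case
    by (intro exI[of _ e]) auto
next
  case (Suc K)
  obtain d where "d > 0" and d: "\<And>n x y. x \<in> (\<Union>n. \<Union>i. W i n) \<Longrightarrow> y \<in> (\<Union>n. \<Union>i. W i n) \<Longrightarrow>
      dist x y < d \<Longrightarrow> dist (f n x) (f n y) < e"
    using equi_continuous Suc.prems unfolding equi_continuous_on_def by meson
  \<comment> \<open>The bound \<open>d\<close> prepares one more application of \<open>f\<close>,
    and the bound \<open>e\<close> covers the earlier times.\<close>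
  have "min d e > 0"
    using \<open>d > 0\<close> Suc.prems by simp
  from Suc.IH[OF this] obtain d' where "d' > 0"
    and d': "\<And>n x y k. tracked n x \<Longrightarrow> tracked n y \<Longrightarrow>
           dist x y < d' \<Longrightarrow> k \<le> K \<Longrightarrow> dist (iter f n k x) (iter f n k y) < min d e"
    by blast
  show ?case
  proof (intro exI[of _ d'] conjI allI impI)
    fix n x y k
    assume x: "tracked n x" and y: "tracked n y"
      and xy: "dist x y < d'" and k: "k \<le> Suc K"
    note K = d'[OF x y xy]
    show "dist (iter f n k x) (iter f n k y) < e"
    proof (cases "k = Suc K")
      case True
      have "dist (f (n + K) (iter f n K x)) (f (n + K) (iter f n K y)) < e"
        using x y K[of K] by (intro d) (auto simp: tracked_def)
      then show ?thesis
        by (simp add: True)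
    next
      case False
      then show ?thesis
        using K[of k] k by simp
    qed
  qed (rule \<open>d' > 0\<close>)
qed

text \<open>The maps are not assumed continuous on the whole space, so preimages under iterates may
  fail to be closed. Peeling off the first condition leaves a preimage inside
  \<open>W (\<alpha> 0) n\<close>, where \<open>f n\<close> is continuous.\<close>

lemma compact_itinerary_set: "compact (itinerary_set f W \<alpha> m n)"
proof (induction m arbitrary: \<alpha> n)
  case 0
  have "itinerary_set f W \<alpha> 0 n = W (\<alpha> 0) n"
    by (auto simp: itinerary_set_iff)
  then show ?case
    by (simp add: compact_W)
next
  case (Suc m)
  have "closed (W (\<alpha> 0) n \<inter> f n -` itinerary_set f W (shift \<alpha>) m (Suc n))"
    by (intro continuous_closed_preimage continuous_on_W compact_imp_closed compact_W Suc.IH)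
  then have "compact (W (\<alpha> 0) n \<inter> (W (\<alpha> 0) n \<inter> f n -` itinerary_set f W (shift \<alpha>) m (Suc n)))"
    by (intro compact_Int_closed compact_W)
  then show ?case
    by (simp add: itinerary_set_Suc)
qed

text \<open>The hypothesis is uniform in \<open>n\<close> for each \<alpha>. Uniformity in \<alpha>
  follows from the finite cylinder cover, since an itinerary set depends on finitely many symbols
  and shrinks as more are imposed.\<close>

lemma uniform_diameter:
  assumes "e > 0"
  obtains m where "\<And>\<alpha> n. \<alpha> \<in> subshift A \<Longrightarrow> diameter (itinerary_set f W \<alpha> m n) < e"
proof -
  have "\<exists>m. \<forall>n. diameter (itinerary_set f W \<alpha> m n) < e" if "\<alpha> \<in> subshift A" for \<alpha>
  proof -
    have "\<forall>\<^sub>F m in sequentially. \<forall>n\<in>UNIV. dist (diameter (itinerary_set f W \<alpha> m n)) 0 < e"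
      using uniform_limitD[OF diameter_itinerary_set[OF that] assms] .
    then show ?thesis
      by (auto simp: eventually_sequentially dist_real_def dest: abs_less_iff[THEN iffD1])
  qed
  then obtain F where F: "\<And>\<alpha> n. \<alpha> \<in> subshift A \<Longrightarrow> diameter (itinerary_set f W \<alpha> (F \<alpha>) n) < e"
    by metis
  obtain M where M: "\<And>\<beta>. \<beta> \<in> subshift A \<Longrightarrow> \<exists>\<alpha>\<in>subshift A. F \<alpha> \<le> M \<and> (\<forall>k\<le>F \<alpha>. \<beta> k = \<alpha> k)"
    using subshift_finite_cylinder_cover[of A F] by blast
  show ?thesis
  proof (rule that)
    fix \<beta> n assume "\<beta> \<in> subshift A"
    then obtain \<alpha> where \<alpha>: "\<alpha> \<in> subshift A" "F \<alpha> \<le> M" "\<And>k. k \<le> F \<alpha> \<Longrightarrow> \<beta> k = \<alpha> k"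
      using M by blast
    have "itinerary_set f W \<beta> M n \<subseteq> itinerary_set f W \<beta> (F \<alpha>) n"
      using \<alpha>(2) by (rule itinerary_set_antimono)
    also have "\<dots> = itinerary_set f W \<alpha> (F \<alpha>) n"
      using \<alpha>(3) by (rule itinerary_set_cong)
    finally have "diameter (itinerary_set f W \<beta> M n) \<le> diameter (itinerary_set f W \<alpha> (F \<alpha>) n)"
      by (intro diameter_subset compact_imp_bounded compact_itinerary_set)
    then show "diameter (itinerary_set f W \<beta> M n) < e"
      using F[OF \<alpha>(1), of n] by linarith
  qed
qed

section \<open>Points with a prescribed itinerary\<close>

lemma dist_itinerary_set_le:
  "x \<in> itinerary_set f W \<alpha> m n \<Longrightarrow> y \<in> itinerary_set f W \<alpha> m n \<Longrightarrow>
    dist x y \<le> diameter (itinerary_set f W \<alpha> m n)"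
  by (intro diameter_bounded_bound compact_imp_bounded compact_itinerary_set)

text \<open>Existence is the finite intersection property of nested nonempty compact sets.
  Uniqueness holds because two such points share all these sets, whose diameters tend to 0.\<close>

lemma ex1_point:
  assumes \<alpha>: "\<alpha> \<in> subshift A"
  shows "\<exists>!x. \<forall>k. iter f n k x \<in> W (\<alpha> k) (n + k)"
proof (rule ex_ex1I)
  have "itinerary_set f W \<alpha> 0 n \<inter> (\<Inter>m\<in>UNIV. itinerary_set f W \<alpha> m n) \<noteq> {}"
  proof (rule compact_imp_fip_image)
    fix I :: "nat set" assume I: "finite I"
    \<comment> \<open>The set with the largest index is contained in all the others; inserting 0
      also handles an empty \<open>I\<close>.\<close>
    have "itinerary_set f W \<alpha> (Max (insert 0 I)) n \<subseteq> itinerary_set f W \<alpha> 0 n \<inter> (\<Inter>m\<in>I. itinerary_set f W \<alpha> m n)"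
      using I by (intro Int_greatest INT_greatest itinerary_set_antimono Max_ge) auto
    then show "itinerary_set f W \<alpha> 0 n \<inter> (\<Inter>m\<in>I. itinerary_set f W \<alpha> m n) \<noteq> {}"
      using itinerary_set_nonempty[OF \<alpha>] by blast
  qed (auto intro: compact_itinerary_set compact_imp_closed)
  then obtain x where "\<And>m. x \<in> itinerary_set f W \<alpha> m n"
    by blast
  then show "\<exists>x. \<forall>k. iter f n k x \<in> W (\<alpha> k) (n + k)"
    unfolding itinerary_set_iff by blast
next
  fix x y
  assume x: "\<forall>k. iter f n k x \<in> W (\<alpha> k) (n + k)" and y: "\<forall>k. iter f n k y \<in> W (\<alpha> k) (n + k)"
  show "x = y"
  proof (rule ccontr)
    assume "x \<noteq> y"
    then have "dist x y > 0"
      by simp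
    then obtain m where m: "\<And>\<alpha> n. \<alpha> \<in> subshift A \<Longrightarrow> diameter (itinerary_set f W \<alpha> m n) < dist x y"
      using uniform_diameter by blast
    have "dist x y \<le> diameter (itinerary_set f W \<alpha> m n)"
      using x y by (intro dist_itinerary_set_le) (auto simp: itinerary_set_iff)
    then show False
      using m[OF \<alpha>, of n] by simp
  qed
qed

text \<open>This is the inverse of the coding map; the conjugacy is later obtained by inverting it
  on the subshift.\<close>

definition point :: "nat \<Rightarrow> (nat \<Rightarrow> 'n) \<Rightarrow> 'a" where
  "point n \<alpha> = (THE x. \<forall>k. iter f n k x \<in> W (\<alpha> k) (n + k))"

lemma iter_point_in_W: "\<alpha> \<in> subshift A \<Longrightarrow> iter f n k (point n \<alpha>) \<in> W (\<alpha> k) (n + k)"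
  unfolding point_def using theI'[OF ex1_point[of \<alpha> n]] by blast

lemma tracked_point: "\<alpha> \<in> subshift A \<Longrightarrow> tracked n (point n \<alpha>)"
  unfolding tracked_def using iter_point_in_W[of \<alpha> n] by blast

lemma point_eqI:
  assumes "\<alpha> \<in> subshift A" "\<And>k. iter f n k x \<in> W (\<alpha> k) (n + k)"
  shows "point n \<alpha> = x"
  unfolding point_def using ex1_point[OF assms(1)] assms(2) by (intro the1_equality) auto

lemma point_in_itinerary_set: "\<alpha> \<in> subshift A \<Longrightarrow> point n \<alpha> \<in> itinerary_set f W \<alpha> m n"
  by (simp add: itinerary_set_iff iter_point_in_W)

text \<open>After \<open>j\<close> steps the orbit has the shifted itinerary, and an admissible
  itinerary determines its point.\<close>

lemma iter_point:
  assumes "\<alpha> \<in> subshift A"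
  shows "iter f n j (point n \<alpha>) = point (n + j) ((shift ^^ j) \<alpha>)"
proof (rule point_eqI[symmetric])
  show "iter f (n + j) k (iter f n j (point n \<alpha>)) \<in> W ((shift ^^ j) \<alpha> k) (n + j + k)" for k
    using iter_point_in_W[OF assms, of n "j + k"] by (simp only: iter_add shift_funpow add.assoc)
qed (rule shift_funpow_in_subshift[OF assms])

lemma f_point: "\<alpha> \<in> subshift A \<Longrightarrow> f n (point n \<alpha>) = point (Suc n) (shift \<alpha>)"
  using iter_point[of \<alpha> n 1] by simp

lemma inj_on_point: "inj_on (point n) (subshift A)"
proof (intro inj_onI ext)
  fix \<alpha> \<beta> k assume ab: "\<alpha> \<in> subshift A" "\<beta> \<in> subshift A" and eq: "point n \<alpha> = point n \<beta>"
  show "\<alpha> k = \<beta> k"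
    using iter_point_in_W[OF ab(1), of n k] iter_point_in_W[OF ab(2), of n k]
    unfolding eq by (rule W_inj)
qed

text \<open>Sequences that agree up to \<open>m\<close> have their points in one common itinerary
  set, whose diameter is small uniformly in \<open>n\<close>.\<close>

lemma point_equi_continuous:
  assumes "e > 0"
  obtains m where "\<And>n \<alpha> \<beta>. \<alpha> \<in> subshift A \<Longrightarrow> \<beta> \<in> subshift A \<Longrightarrow> (\<And>k. k \<le> m \<Longrightarrow> \<alpha> k = \<beta> k) \<Longrightarrow>
    dist (point n \<alpha>) (point n \<beta>) < e"
proof -
  obtain m where m: "\<And>\<alpha> n. \<alpha> \<in> subshift A \<Longrightarrow> diameter (itinerary_set f W \<alpha> m n) < e"
    using uniform_diameter[OF assms] by blast
  show ?thesis
  proof (rule that)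
    fix n \<alpha> \<beta>
    assume \<alpha>: "\<alpha> \<in> subshift A" and \<beta>: "\<beta> \<in> subshift A" and eq: "\<And>k. k \<le> m \<Longrightarrow> \<alpha> k = \<beta> k"
    have "itinerary_set f W \<beta> m n = itinerary_set f W \<alpha> m n"
      using eq by (intro itinerary_set_cong) auto
    then have "dist (point n \<alpha>) (point n \<beta>) \<le> diameter (itinerary_set f W \<alpha> m n)"
      using point_in_itinerary_set[OF \<alpha>] point_in_itinerary_set[OF \<beta>]
      by (intro dist_itinerary_set_le) auto
    then show "dist (point n \<alpha>) (point n \<beta>) < e"
      using m[OF \<alpha>, of n] by linarith
  qed
qed

text \<open>Orbits of sufficiently close points stay within the separation constant for
  \<open>K\<close> steps, which forces equal symbols at these times.\<close>

lemma code_equi_continuous: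
  obtains d where "d > 0" "\<And>n \<alpha> \<beta> k. \<alpha> \<in> subshift A \<Longrightarrow> \<beta> \<in> subshift A \<Longrightarrow>
    dist (point n \<alpha>) (point n \<beta>) < d \<Longrightarrow> k \<le> K \<Longrightarrow> \<alpha> k = \<beta> k"
proof -
  obtain \<eta> where \<eta>: "\<eta> > 0" "\<And>i j x y n m. x \<in> W i n \<Longrightarrow> y \<in> W j m \<Longrightarrow> dist x y < \<eta> \<Longrightarrow> i = j"
    using separation by blast
  obtain d where "d > 0" and d: "\<And>n x y k. tracked n x \<Longrightarrow>
      tracked n y \<Longrightarrow> dist x y < d \<Longrightarrow> k \<le> K \<Longrightarrow>
      dist (iter f n k x) (iter f n k y) < \<eta>"
    using iter_equi_continuous[OF \<eta>(1), of K] by blast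
  show ?thesis
  proof (rule that[OF \<open>d > 0\<close>])
    fix n \<alpha> \<beta> k
    assume \<alpha>: "\<alpha> \<in> subshift A" and \<beta>: "\<beta> \<in> subshift A"
      and lt: "dist (point n \<alpha>) (point n \<beta>) < d" and k: "k \<le> K"
    have "dist (iter f n k (point n \<alpha>)) (iter f n k (point n \<beta>)) < \<eta>"
      by (intro d[OF _ _ lt k] tracked_point \<alpha> \<beta>)
    then show "\<alpha> k = \<beta> k"
      by (rule \<eta>(2)[OF iter_point_in_W[OF \<alpha>] iter_point_in_W[OF \<beta>]])
  qed
qed

section \<open>The invariant compact sets and the conjugacy\<close>

definition limit_set :: "nat \<Rightarrow> 'a set" where
  "limit_set n = point n ` subshift A"

lemma limit_set_nonempty: "limit_set n \<noteq> {}"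
proof -
  obtain s where "s \<in> subshift A"
    using subshift_exists[OF transition] by blast
  then show ?thesis
    by (auto simp: limit_set_def)
qed

lemma limit_set_subset: "limit_set n \<subseteq> (\<Union>i. W i n)"
  using iter_point_in_W[of _ n 0] by (auto simp: limit_set_def)

lemma f_image_limit_set: "f n ` limit_set n = limit_set (Suc n)"
proof -
  have "f n ` limit_set n = point (Suc n) ` shift ` subshift A"
    unfolding limit_set_def image_image by (rule image_cong) (simp_all add: f_point)
  then show ?thesis
    by (simp add: limit_set_def shift_image_subshift[OF transition])
qed

text \<open>The limit set is an intersection of finite unions of compact itinerary sets. The harder
  inclusion glues finite itineraries of a point into one admissible sequence.\<close>

lemma compact_limit_set: "compact (limit_set n)"
proof -
  define U where "U m = (\<Union>\<alpha>\<in>subshift A. itinerary_set f W \<alpha> m n)" for m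
  have "closed (U m)" for m
  proof -
    \<comment> \<open>Only the first \<open>m + 1\<close> symbols matter, so the union over the
      subshift runs over finitely many words.\<close>
    have "itinerary_set f W \<alpha> m n = (\<lambda>w. itinerary_set f W ((!) w) m n) (map \<alpha> [0..<Suc m])" for \<alpha>
      by (auto intro!: itinerary_set_cong simp del: upt_Suc)
    then have "U m = (\<Union>w\<in>admissible_words A (Suc m). itinerary_set f W ((!) w) m n)"
      by (simp add: U_def admissible_words_def del: upt_Suc)
    then show ?thesis
      by (auto intro!: closed_UN compact_imp_closed compact_itinerary_set)
  qed
  then have "compact ((\<Union>i. W i n) \<inter> (\<Inter>m. U m))"
    by (intro compact_Int_closed compact_UN closed_INT) (auto intro: compact_W)
  also have "(\<Union>i. W i n) \<inter> (\<Inter>m. U m) = limit_set n"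
  proof (intro equalityI subsetI)
    fix x assume x: "x \<in> limit_set n"
    then obtain \<alpha> where "\<alpha> \<in> subshift A" "x = point n \<alpha>"
      by (auto simp: limit_set_def)
    then have "x \<in> U m" for m
      unfolding U_def using point_in_itinerary_set by blast
    then show "x \<in> (\<Union>i. W i n) \<inter> (\<Inter>m. U m)"
      using x limit_set_subset by blast
  next
    fix x assume "x \<in> (\<Union>i. W i n) \<inter> (\<Inter>m. U m)"
    then have "\<forall>m. \<exists>\<alpha>. \<alpha> \<in> subshift A \<and> x \<in> itinerary_set f W \<alpha> m n"
      by (auto simp: U_def)
    from choice[OF this] obtain a
      where a: "\<And>m. a m \<in> subshift A" "\<And>m. x \<in> itinerary_set f W (a m) m n"
      by blast
    \<comment> \<open>Separation makes the itineraries of \<open>x\<close> consistent with each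
      other, so their diagonal is again an itinerary of \<open>x\<close>.\<close>
    have eq: "a m k = a k k" if "k \<le> m" for m k
    proof (rule W_inj)
      show "iter f n k x \<in> W (a m k) (n + k)" "iter f n k x \<in> W (a k k) (n + k)"
        using a(2)[of m] a(2)[of k] that unfolding itinerary_set_iff by blast+
    qed
    have s: "(\<lambda>k. a k k) \<in> subshift A"
      unfolding subshift_def
    proof (intro CollectI allI)
      fix j
      \<comment> \<open>The single sequence \<open>a (Suc j)\<close> contains both diagonal symbols,
        so the transition between them is allowed.\<close>
      have "A $ a (Suc j) j $ a (Suc j) (Suc j) = 1"
        using a(1)[of "Suc j"] unfolding subshift_def by blast
      then show "A $ a j j $ a (Suc j) (Suc j) = 1"
        using eq[of j "Suc j"] by simp
    qed
    moreover have "point n (\<lambda>k. a k k) = x"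
      using a(2) by (intro point_eqI[OF s]) (auto simp: itinerary_set_iff)
    ultimately show "x \<in> limit_set n"
      unfolding limit_set_def by blast
  qed
  finally show ?thesis .
qed

lemma equi_conjugate_limit_set: "equi_conjugate_to_subshift f limit_set A"
proof -
  define h where "h n = inv_into (subshift A) (point n)" for n
  have h: "h n (point n \<alpha>) = \<alpha>" if "\<alpha> \<in> subshift A" for n \<alpha>
    unfolding h_def using inj_on_point that by (rule inv_into_f_f)
  have bij: "bij_betw (h n) (limit_set n) (subshift A)" for n
    unfolding h_def limit_set_def by (intro bij_betw_inv_into inj_on_imp_bij_betw inj_on_point)
  have inv: "inv_into (limit_set n) (h n) \<alpha> = point n \<alpha>" if "\<alpha> \<in> subshift A" for n \<alpha>
    using bij that by (intro inv_into_f_eq h) (auto simp: bij_betw_def limit_set_def)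
  have "equi_continuous_on dist seq_dist limit_set h"
    unfolding equi_continuous_on_def
  proof (intro allI impI)
    fix e :: real assume e: "e > 0"
    \<comment> \<open>Agreement up to index \<open>K\<close> means \<open>K + 1\<close> common
      symbols, hence distance at most \<open>2 / 2 ^ Suc K\<close>, which is
      \<open>(1 / 2) ^ K\<close>.\<close>
    obtain K where K: "(1 / 2) ^ K < e"
      using real_arch_pow_inv[OF e, of "1 / 2"] by auto
    obtain d where d: "d > 0" "\<And>n \<alpha> \<beta> k. \<alpha> \<in> subshift A \<Longrightarrow> \<beta> \<in> subshift A \<Longrightarrow>
        dist (point n \<alpha>) (point n \<beta>) < d \<Longrightarrow> k \<le> K \<Longrightarrow> \<alpha> k = \<beta> k"
      using code_equi_continuous[of K] by blast
    show "\<exists>d>0. \<forall>n. \<forall>x\<in>limit_set n. \<forall>y\<in>limit_set n. dist x y < d \<longrightarrow> seq_dist (h n x) (h n y) < e"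
    proof (intro exI[of _ d] conjI allI ballI impI d(1))
      fix n x y assume "x \<in> limit_set n" "y \<in> limit_set n" and xy: "dist x y < d"
      then obtain \<alpha> \<beta> where ab: "\<alpha> \<in> subshift A" "\<beta> \<in> subshift A" "x = point n \<alpha>" "y = point n \<beta>"
        by (auto simp: limit_set_def)
      have "seq_dist \<alpha> \<beta> \<le> 2 / 2 ^ Suc K"
        using d(2)[OF ab(1,2)] xy ab(3,4) by (intro seq_dist_le_if_agree) auto
      also have "\<dots> = (1 / 2) ^ K"
        by (simp add: power_one_over)
      finally show "seq_dist (h n x) (h n y) < e"
        using K ab h by simp
    qed
  qed
  moreover have "equi_continuous_on seq_dist dist (\<lambda>_. subshift A) (\<lambda>n. inv_into (limit_set n) (h n))"
    unfolding equi_continuous_on_def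
  proof (intro allI impI)
    fix e :: real assume e: "e > 0"
    obtain m where m: "\<And>n \<alpha> \<beta>. \<alpha> \<in> subshift A \<Longrightarrow> \<beta> \<in> subshift A \<Longrightarrow> (\<And>k. k \<le> m \<Longrightarrow> \<alpha> k = \<beta> k) \<Longrightarrow>
        dist (point n \<alpha>) (point n \<beta>) < e"
      using point_equi_continuous[OF e] by blast
    show "\<exists>d>0. \<forall>n. \<forall>x\<in>subshift A. \<forall>y\<in>subshift A. seq_dist x y < d \<longrightarrow>
        dist (inv_into (limit_set n) (h n) x) (inv_into (limit_set n) (h n) y) < e"
    proof (intro exI[of _ "1 / 2 ^ m"] conjI allI ballI impI)
      fix n x y
      assume x: "x \<in> subshift A" and y: "y \<in> subshift A" and xy: "seq_dist x y < 1 / 2 ^ m"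
      show "dist (inv_into (limit_set n) (h n) x) (inv_into (limit_set n) (h n) y) < e"
        unfolding inv[OF x] inv[OF y]
        by (rule m[OF x y]) (rule seq_dist_less_imp_agree[OF xy])
    qed simp
  qed
  moreover have "h (Suc n) (f n x) = shift (h n x)" if "x \<in> limit_set n" for n x
    using that by (auto simp: limit_set_def f_point h shift_in_subshift)
  ultimately show ?thesis
    unfolding equi_conjugate_to_subshift_def using bij f_image_limit_set by blast
qed

end

section \<open>Entropy\<close>

lemma log_enat_le: "k \<le> enat c \<Longrightarrow> c > 0 \<Longrightarrow> log_enat k \<le> ereal (ln (real c))"
  \<comment> \<open>The value 0 is split off because monotonicity of \<open>ln\<close> needs
    positive arguments; there \<open>ln 0 = 0\<close>.\<close>
  by (cases k; cases "k = 0") (auto simp: log_enat_def zero_enat_def)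

lemma le_log_enat: "enat c \<le> k \<Longrightarrow> c > 0 \<Longrightarrow> ereal (ln (real c)) \<le> log_enat k"
  by (cases k) (auto simp: log_enat_def)

section \<open>Upper and lower entropy bounds by word counts\<close>

context itinerary_system
begin

lemma words_representatives:
  obtains r where "\<And>w. w \<in> admissible_words A n \<Longrightarrow> r w \<in> subshift A"
    and "\<And>w. w \<in> admissible_words A n \<Longrightarrow> map (r w) [0..<n] = w"
proof -
  have "\<forall>w. \<exists>s. w \<in> admissible_words A n \<longrightarrow> s \<in> subshift A \<and> map s [0..<n] = w"
    by (auto simp: admissible_words_def)
  from choice[OF this] show ?thesis
    using that by blast
qed

text \<open>The \<open>m + 1\<close> symbols from time \<open>j\<close> on determine an itinerary
  set containing the \<open>j\<close>-th iterate. A word of length \<open>n + Suc m\<close> contains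
  these windows for all \<open>j < n\<close>, so one member of the iterated cover per word
  suffices.\<close>

lemma min_subcover_le:
  assumes cover: "\<And>j \<alpha>. \<alpha> \<in> subshift A \<Longrightarrow> \<exists>B\<in>\<A>. itinerary_set f W \<alpha> m j \<subseteq> B"
  shows "min_subcover (restrict_cover (iterated_cover f \<A> n) (limit_set 0)) (limit_set 0)
           \<le> enat (card (admissible_words A (n + Suc m)))"
proof -
  define b where "b j \<alpha> = (SOME B. B \<in> \<A> \<and> itinerary_set f W \<alpha> m j \<subseteq> B)" for j \<alpha>
  have b: "b j \<alpha> \<in> \<A>" "itinerary_set f W \<alpha> m j \<subseteq> b j \<alpha>" if "\<alpha> \<in> subshift A" for j \<alpha>
    using someI_ex[of "\<lambda>B. B \<in> \<A> \<and> itinerary_set f W \<alpha> m j \<subseteq> B"] cover[OF that, of j]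
    unfolding b_def by blast+
  obtain r where r: "\<And>w. w \<in> admissible_words A (n + Suc m) \<Longrightarrow> r w \<in> subshift A"
      "\<And>w. w \<in> admissible_words A (n + Suc m) \<Longrightarrow> map (r w) [0..<n + Suc m] = w"
    using words_representatives[of "n + Suc m"] by blast
  define D where "D w = (\<Inter>j\<in>{..<n}. iter f 0 j -` b j ((shift ^^ j) (r w))) \<inter> limit_set 0" for w
  let ?\<D> = "D ` admissible_words A (n + Suc m)"
  have "?\<D> \<subseteq> restrict_cover (iterated_cover f \<A> n) (limit_set 0)"
  proof
    fix Y assume "Y \<in> ?\<D>"
    then obtain w where w: "w \<in> admissible_words A (n + Suc m)" "Y = D w"
      by blast
    have "(\<Inter>j\<in>{..<n}. iter f 0 j -` b j ((shift ^^ j) (r w))) \<in> iterated_cover f \<A> n"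
      unfolding iterated_cover_def
      by (intro CollectI exI[of _ "\<lambda>j. b j ((shift ^^ j) (r w))"] conjI refl allI impI b(1)
          shift_funpow_in_subshift r(1) w(1))
    then show "Y \<in> restrict_cover (iterated_cover f \<A> n) (limit_set 0)"
      by (auto simp: restrict_cover_def w(2) D_def)
  qed
  moreover have "limit_set 0 \<subseteq> \<Union>?\<D>"
  proof
    fix x assume x: "x \<in> limit_set 0"
    then obtain \<alpha> where \<alpha>: "\<alpha> \<in> subshift A" "x = point 0 \<alpha>"
      by (auto simp: limit_set_def)
    define w where "w = map \<alpha> [0..<n + Suc m]"
    have w: "w \<in> admissible_words A (n + Suc m)"
      using \<alpha>(1) by (auto simp: admissible_words_def w_def)
    have agree: "r w k = \<alpha> k" if "k < n + Suc m" for k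
    proof -
      have "map (r w) [0..<n + Suc m] ! k = w ! k"
        using r(2)[OF w] by simp
      then show ?thesis
        using that by (simp add: w_def del: upt_Suc)
    qed
    have "iter f 0 j x \<in> b j ((shift ^^ j) (r w))" if "j < n" for j
    proof -
      have s: "(shift ^^ j) \<alpha> \<in> subshift A" "(shift ^^ j) (r w) \<in> subshift A"
        by (intro shift_funpow_in_subshift \<alpha> r w)+
      have "iter f 0 j x = point j ((shift ^^ j) \<alpha>)"
        using iter_point[OF \<alpha>(1), of 0 j] by (simp add: \<alpha>(2))
      moreover have "itinerary_set f W ((shift ^^ j) \<alpha>) m j = itinerary_set f W ((shift ^^ j) (r w)) m j"
        using agree that by (intro itinerary_set_cong) (simp add: shift_funpow)
      ultimately have "iter f 0 j x \<in> itinerary_set f W ((shift ^^ j) (r w)) m j"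
        using point_in_itinerary_set[OF s(1), of j m] by simp
      then show ?thesis
        using b(2)[OF s(2)] by blast
    qed
    then have "x \<in> D w"
      using x by (simp add: D_def)
    then show "x \<in> \<Union>?\<D>"
      using w by blast
  qed
  ultimately have "min_subcover (restrict_cover (iterated_cover f \<A> n) (limit_set 0)) (limit_set 0) \<le> enat (card ?\<D>)"
    unfolding min_subcover_def by (intro Inf_lower CollectI exI[of _ ?\<D>]) simp
  also have "\<dots> \<le> enat (card (admissible_words A (n + Suc m)))"
    by (simp add: card_image_le)
  finally show ?thesis .
qed

text \<open>A member of the iterated cover fixes the symbol at each of the \<open>n\<close> times,
  so points representing different words lie in different members of a subcover.\<close>

lemma le_min_subcover:
  assumes small: "\<And>B i j n m x y. B \<in> \<A> \<Longrightarrow> x \<in> B \<inter> W i n \<Longrightarrow> y \<in> B \<inter> W j m \<Longrightarrow> i = j"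
  shows "enat (card (admissible_words A n))
           \<le> min_subcover (restrict_cover (iterated_cover f \<A> n) (limit_set 0)) (limit_set 0)"
  unfolding min_subcover_def
proof (rule Inf_greatest, safe)
  fix \<D> assume sub: "\<D> \<subseteq> restrict_cover (iterated_cover f \<A> n) (limit_set 0)"
    and fin: "finite \<D>" and cov: "limit_set 0 \<subseteq> \<Union>\<D>"
  obtain r where r: "\<And>w. w \<in> admissible_words A n \<Longrightarrow> r w \<in> subshift A"
      "\<And>w. w \<in> admissible_words A n \<Longrightarrow> map (r w) [0..<n] = w"
    using words_representatives[of n] by blast
  have "\<forall>w. \<exists>D. w \<in> admissible_words A n \<longrightarrow> D \<in> \<D> \<and> point 0 (r w) \<in> D"
    using cov r(1) by (auto simp: limit_set_def)
  from choice[OF this] obtain D where D: "\<And>w. w \<in> admissible_words A n \<Longrightarrow> D w \<in> \<D>"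
      "\<And>w. w \<in> admissible_words A n \<Longrightarrow> point 0 (r w) \<in> D w"
    by blast
  have "inj_on D (admissible_words A n)"
  proof (rule inj_onI)
    fix v w assume v: "v \<in> admissible_words A n" and w: "w \<in> admissible_words A n" and eq: "D v = D w"
    have "D w \<in> restrict_cover (iterated_cover f \<A> n) (limit_set 0)"
      using D(1)[OF w] sub by (rule subsetD[rotated])
    then obtain C where C: "\<And>j. j < n \<Longrightarrow> C j \<in> \<A>"
        "D w = (\<Inter>j\<in>{..<n}. iter f 0 j -` C j) \<inter> limit_set 0"
      unfolding restrict_cover_def iterated_cover_def by blast
    have D_imp: "iter f 0 j y \<in> C j" if "y \<in> D w" "j < n" for y j
      using that unfolding C(2) by simp
    have "r v j = r w j" if "j < n" for j
    proof (rule small[OF C(1)[OF that]])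
      show "iter f 0 j (point 0 (r v)) \<in> C j \<inter> W (r v j) (0 + j)"
        using D(2)[OF v] iter_point_in_W[OF r(1)[OF v]] unfolding eq by (intro IntI D_imp that)
      show "iter f 0 j (point 0 (r w)) \<in> C j \<inter> W (r w j) (0 + j)"
        using D(2)[OF w] iter_point_in_W[OF r(1)[OF w]] by (intro IntI D_imp that)
    qed
    then have "map (r v) [0..<n] = map (r w) [0..<n]"
      by simp
    then show "v = w"
      using r(2) v w by simp
  qed
  then show "enat (card (admissible_words A n)) \<le> enat (card \<D>)"
    using card_inj_on_le[OF _ _ fin, of D "admissible_words A n"] D(1) by auto
qed

lemma topological_entropy_limit_set:
  assumes comp: "compact (UNIV :: 'a set)"
  shows "topological_entropy f (limit_set 0) = ereal (ln (matrix_rho A))"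
proof (rule antisym)
  let ?N = "\<lambda>\<A> n. min_subcover (restrict_cover (iterated_cover f \<A> n) (limit_set 0)) (limit_set 0)"
  have lim: "limsup (\<lambda>n. ereal (1 / real n) * ereal (ln (card (admissible_words A (n + k))))) =
      ereal (ln (matrix_rho A))" for k
    using ln_card_admissible_words_tendsto[OF transition, of k]
    by (intro lim_imp_Limsup) simp_all
  show "topological_entropy f (limit_set 0) \<le> ereal (ln (matrix_rho A))"
    unfolding topological_entropy_def
  proof (rule SUP_least)
    fix \<A> :: "'a set set" assume "\<A> \<in> {\<A>. (\<forall>U\<in>\<A>. open U) \<and> \<Union>\<A> = UNIV}"
    then have open_cover: "\<And>U. U \<in> \<A> \<Longrightarrow> open U" "UNIV \<subseteq> \<Union>\<A>" "\<A> \<noteq> {}"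
      by auto
    \<comment> \<open>Below a Lebesgue number of the cover, each sufficiently long itinerary set
      fits into one member.\<close>
    obtain \<delta> where \<delta>: "\<delta> > 0" "\<And>T. T \<subseteq> UNIV \<Longrightarrow> diameter T < \<delta> \<Longrightarrow> \<exists>B\<in>\<A>. T \<subseteq> B"
      using Lebesgue_number_lemma[OF comp open_cover(3,2,1)] by blast
    obtain m where m: "\<And>\<alpha> n. \<alpha> \<in> subshift A \<Longrightarrow> diameter (itinerary_set f W \<alpha> m n) < \<delta>"
      using uniform_diameter[OF \<delta>(1)] by blast
    have "log_enat (?N \<A> n) \<le> ereal (ln (card (admissible_words A (n + Suc m))))" for n
      by (intro log_enat_le min_subcover_le card_admissible_words_pos transition \<delta>(2) m) auto
    then have "limsup (\<lambda>n. ereal (1 / real n) * log_enat (?N \<A> n)) \<le>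
        limsup (\<lambda>n. ereal (1 / real n) * ereal (ln (card (admissible_words A (n + Suc m)))))"
      by (intro Limsup_mono always_eventually allI ereal_mult_left_mono) auto
    then show "limsup (\<lambda>n. ereal (1 / real n) * log_enat (?N \<A> n)) \<le> ereal (ln (matrix_rho A))"
      unfolding lim .
  qed
  obtain \<eta> where \<eta>: "\<eta> > 0" "\<And>i j x y n m. x \<in> W i n \<Longrightarrow> y \<in> W j m \<Longrightarrow> dist x y < \<eta> \<Longrightarrow> i = j"
    using separation by blast
  \<comment> \<open>Two points of a ball of radius \<open>\<eta> / 2\<close> are closer than
    \<open>\<eta>\<close>, so no ball meets the sets of two different symbols.\<close>
  define \<A> where "\<A> = range (\<lambda>x :: 'a. ball x (\<eta> / 2))"
  have "i = j" if B: "B \<in> \<A>" and xy: "x \<in> B \<inter> W i n" "y \<in> B \<inter> W j m" for B i j n m x y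
  proof -
    obtain c where "B = ball c (\<eta> / 2)"
      using B unfolding \<A>_def by blast
    then have "dist c x < \<eta> / 2" "dist c y < \<eta> / 2"
      using xy by (simp_all add: mem_ball)
    then have "dist x y < \<eta>"
      by (rule dist_triangle_half_r)
    then show ?thesis
      by (rule \<eta>(2)[OF IntD2[OF xy(1)] IntD2[OF xy(2)]])
  qed
  then have le: "enat (card (admissible_words A n)) \<le> ?N \<A> n" for n
    by (rule le_min_subcover)
  have "ereal (ln (matrix_rho A)) =
      limsup (\<lambda>n. ereal (1 / real n) * ereal (ln (card (admissible_words A (n + 0)))))"
    by (simp only: lim)
  also have "\<dots> \<le> limsup (\<lambda>n. ereal (1 / real n) * log_enat (?N \<A> n))"
    by (intro Limsup_mono always_eventually allI ereal_mult_left_mono le_log_enat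
        card_admissible_words_pos transition) (use le in auto)
  also have "\<dots> \<le> topological_entropy f (limit_set 0)"
    unfolding topological_entropy_def
    by (rule SUP_upper) (use \<eta>(1) in \<open>auto simp: \<A>_def\<close>)
  finally show "ereal (ln (matrix_rho A)) \<le> topological_entropy f (limit_set 0)" .
qed

end

section \<open>Chaos\<close>

text \<open>The bound 2 on \<open>m\<close> makes the block from \<open>L * fact m\<close> to
  \<open>L * m * fact m\<close> nonempty; its first index is the witness.\<close>

lemma frequently_in_blocks:
  assumes "L > 0" and block: "\<exists>m\<ge>max N 2. \<forall>i. L * fact m \<le> i \<and> i < L * m * fact m \<longrightarrow> P i"
  shows "\<exists>i\<ge>N. P i"
proof -
  obtain m where m: "m \<ge> max N 2" "\<And>i. L * fact m \<le> i \<Longrightarrow> i < L * m * fact m \<Longrightarrow> P i"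
    using block by blast
  have "m * 1 \<le> fact m * L"
    using assms(1) fact_ge_self[of m] by (intro mult_le_mono) auto
  then have "N \<le> L * fact m"
    using m(1) by (simp add: mult.commute)
  moreover have "P (L * fact m)"
    using m(1) assms(1) by (intro m(2)) auto
  ultimately show ?thesis
    by blast
qed

lemma uncountable_UNIV_nat_set: "uncountable (UNIV :: nat set set)"
  using Cantors_theorem[of "UNIV :: nat set"] unfolding uncountable_def Pow_UNIV by blast

section \<open>Scrambled points from block sequences\<close>

context itinerary_system
begin

lemma block_orbits:
  assumes uv: "loop_pair A u v"
  defines "x \<equiv> \<lambda>X. point 0 (loop_concat u v (block_set X))"
  shows orbits_close: "\<And>e X Y M. e > 0 \<Longrightarrow> \<exists>m\<ge>M. \<forall>i. length u * fact m \<le> i \<and> i < length u * m * fact m \<longrightarrow>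
            dist (iter f 0 i (x X)) (iter f 0 i (x Y)) < e"
    and orbits_apart: "\<exists>\<delta>>0. \<forall>X Y M. X \<noteq> Y \<longrightarrow> (\<exists>m\<ge>M. \<forall>i. length u * fact m \<le> i \<and> i < length u * m * fact m \<longrightarrow>
            dist (iter f 0 i (x X)) (iter f 0 i (x Y)) \<ge> \<delta>)"
proof -
  define L where "L = length u"
  have L: "L \<ge> 2"
    using uv by (simp add: loop_pair_def L_def)
  define a where "a X = loop_concat u v (block_set X)" for X
  have a: "a X \<in> subshift A" for X
    unfolding a_def by (rule loop_concat_in_subshift[OF uv])
  then have sa: "(shift ^^ i) (a X) \<in> subshift A" for i X
    by (rule shift_funpow_in_subshift)
  have it: "iter f 0 i (x X) = point i ((shift ^^ i) (a X))" for i X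
    using iter_point[OF a, of 0 i X] by (simp add: x_def a_def)
  show "\<exists>m\<ge>M. \<forall>i. length u * fact m \<le> i \<and> i < length u * m * fact m \<longrightarrow>
            dist (iter f 0 i (x X)) (iter f 0 i (x Y)) < e" if e: "e > 0" for e X Y M
  proof -
    obtain K where K: "\<And>n \<alpha> \<beta>. \<alpha> \<in> subshift A \<Longrightarrow> \<beta> \<in> subshift A \<Longrightarrow> (\<And>k. k \<le> K \<Longrightarrow> \<alpha> k = \<beta> k) \<Longrightarrow>
        dist (point n \<alpha>) (point n \<beta>) < e"
      using point_equi_continuous[OF e] by blast
    obtain m where m: "m \<ge> max M K"
      and agree: "\<And>k. fact m \<le> k \<Longrightarrow> k < fact (Suc m) \<Longrightarrow> k \<in> block_set X \<longleftrightarrow> k \<in> block_set Y"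
      using block_sets_agree by blast
    have "dist (iter f 0 i (x X)) (iter f 0 i (x Y)) < e" if i: "L * fact m \<le> i" "i < L * m * fact m" for i
      unfolding it
    proof (rule K[OF sa sa])
      fix k assume k: "k \<le> K"
      have "k \<le> m"
        using k m by simp
      also have "m \<le> fact m"
        by (rule fact_ge_self)
      also have "fact m \<le> L * fact m"
        using L by simp
      finally have "i + k < L * fact (Suc m)"
        using i(2) by (simp add: algebra_simps)
      then have "(i + k) div L < fact (Suc m)"
        using L by (simp add: less_mult_imp_div_less mult.commute)
      moreover have "fact m \<le> (i + k) div L"
      proof -
        have "fact m = (L * fact m) div L"
          using L by simp
        also have "\<dots> \<le> (i + k) div L"
          using i(1) by (intro div_le_mono) simp
        finally show ?thesis .
      qed
      ultimately have "(i + k) div L \<in> block_set X \<longleftrightarrow> (i + k) div L \<in> block_set Y"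
        by (intro agree)
      then show "(shift ^^ i) (a X) k = (shift ^^ i) (a Y) k"
        unfolding shift_funpow a_def by (intro loop_concat_eq) (simp add: L_def)
    qed
    then show ?thesis
      using m unfolding L_def by (intro exI[of _ m]) auto
  qed
  \<comment> \<open>From any time, index 1 of the next loop is at most \<open>L + 1\<close> steps
    ahead, hence within \<open>2 * L\<close>.\<close>
  obtain \<delta> where \<delta>: "\<delta> > 0" "\<And>n \<alpha> \<beta> k. \<alpha> \<in> subshift A \<Longrightarrow> \<beta> \<in> subshift A \<Longrightarrow>
      dist (point n \<alpha>) (point n \<beta>) < \<delta> \<Longrightarrow> k \<le> 2 * L \<Longrightarrow> \<alpha> k = \<beta> k"
    using code_equi_continuous[of "2 * L"] by blast
  show "\<exists>\<delta>>0. \<forall>X Y M. X \<noteq> Y \<longrightarrow> (\<exists>m\<ge>M. \<forall>i. length u * fact m \<le> i \<and> i < length u * m * fact m \<longrightarrow>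
            dist (iter f 0 i (x X)) (iter f 0 i (x Y)) \<ge> \<delta>)"
  proof (intro exI[of _ \<delta>] conjI allI impI \<delta>(1))
    fix X Y :: "nat set" and M assume "X \<noteq> Y"
    from block_sets_complementary[OF this, of M] obtain m where m: "m \<ge> M"
      and differ: "\<And>k. fact m \<le> k \<Longrightarrow> k < fact (Suc m) \<Longrightarrow> k \<in> block_set X \<longleftrightarrow> k \<notin> block_set Y"
      by blast
    have "\<not> dist (iter f 0 i (x X)) (iter f 0 i (x Y)) < \<delta>"
      if i: "L * fact m \<le> i" "i < L * m * fact m" for i
      unfolding it
    proof
      assume less: "dist (point i ((shift ^^ i) (a X))) (point i ((shift ^^ i) (a Y))) < \<delta>"
      \<comment> \<open>The next loop is taken because index 1 of the current one may already have
        passed.\<close>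
      define q where "q = Suc (i div L)"
      have i_eq: "i = i div L * L + i mod L"
        by (rule div_mult_mod_eq[symmetric])
      have i_mod: "i mod L < L"
        by (rule mod_less_divisor) (use L in linarith)
      have "fact m = (L * fact m) div L"
        using L by simp
      also have "\<dots> \<le> i div L"
        using i(1) by (rule div_le_mono)
      finally have q1: "fact m \<le> q"
        by (simp add: q_def)
      have "i div L < m * fact m"
        using i(2) L by (intro less_mult_imp_div_less) (simp add: mult_ac)
      then have "q \<le> m * fact m"
        by (simp add: q_def)
      also have "\<dots> < fact (Suc m)"
        by simp
      finally have q2: "q < fact (Suc m)" .
      have qL: "q * L + 1 = i div L * L + L + 1"
        by (simp add: q_def)
      then have ge: "i \<le> q * L + 1" and le: "q * L + 1 - i \<le> 2 * L"
        using i_eq i_mod L by linarith+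
      have "a X (q * L + 1) = a Y (q * L + 1)"
        using \<delta>(2)[OF sa sa less le] unfolding shift_funpow le_add_diff_inverse[OF ge] .
      then show False
        using loop_concat_neq[OF uv differ[OF q1 q2]] unfolding a_def L_def by contradiction
    qed
    then show "\<exists>m\<ge>M. \<forall>i. length u * fact m \<le> i \<and> i < length u * m * fact m \<longrightarrow>
            dist (iter f 0 i (x X)) (iter f 0 i (x Y)) \<ge> \<delta>"
      using m unfolding L_def not_less by (intro exI[of _ m]) auto
  qed
qed

lemma chaotic:
  assumes irr: "irreducible_matrix A" and row: "(\<Sum>j\<in>UNIV. A $ i $ j) \<ge> 2"
  shows "(\<exists>\<delta>>0. li_yorke_chaotic \<delta> f) \<and> distributionally_chaotic f"
proof -
  obtain u v where uv: "loop_pair A u v"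
    using loop_pair_exists[OF transition irr row] by blast
  define L where "L = length u"
  have L: "L > 0"
    using uv by (auto simp: loop_pair_def L_def)
  define x where "x X = point 0 (loop_concat u v (block_set X))" for X
  define d where "d X Y i = dist (iter f 0 i (x X)) (iter f 0 i (x Y))" for X Y i
  have near: "\<exists>m\<ge>M. \<forall>i. L * fact m \<le> i \<and> i < L * m * fact m \<longrightarrow> d X Y i < e" if "e > 0" for e X Y M
    using orbits_close[OF uv that] unfolding d_def x_def L_def by blast
  from orbits_apart[OF uv] obtain \<delta> where \<delta>: "\<delta> > 0"
    and far: "\<And>X Y M. X \<noteq> Y \<Longrightarrow>
      \<exists>m\<ge>M. \<forall>i. L * fact m \<le> i \<and> i < L * m * fact m \<longrightarrow> d X Y i \<ge> \<delta>"
    unfolding d_def x_def L_def by blast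
  \<comment> \<open>Orbits of points from different sets are apart at some time, so the points
    differ and their range is uncountable.\<close>
  have "inj x"
  proof (rule injI, rule ccontr)
    fix X Y assume eq: "x X = x Y" and "X \<noteq> Y"
    then obtain i where "d X Y i \<ge> \<delta>"
      using frequently_in_blocks[OF L far[OF \<open>X \<noteq> Y\<close>]] by blast
    then show False
      using \<delta> eq by (simp add: d_def)
  qed
  then have S: "uncountable (range x)"
    using countable_image_inj_on uncountable_UNIV_nat_set by blast
  \<comment> \<open>Distances of at least \<open>\<delta>\<close> recur, which only bounds the
    limsup below by \<open>\<delta>\<close>; halving gives the strict inequality.\<close>
  have "li_yorke_chaotic (\<delta> / 2) f"
    unfolding li_yorke_chaotic_def
  proof (intro exI[of _ "range x"] conjI S ballI impI)
    fix p q assume "p \<in> range x" "q \<in> range x" "p \<noteq> q"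
    then obtain X Y where pq: "p = x X" "q = x Y" "X \<noteq> Y"
      by blast
    show "liminf (\<lambda>n. ereal (dist (iter f 0 n p) (iter f 0 n q))) = 0"
      unfolding pq d_def[symmetric]
    proof (rule antisym)
      show "0 \<le> liminf (\<lambda>n. ereal (d X Y n))"
        by (intro Liminf_bounded always_eventually allI) (simp add: d_def)
      show "liminf (\<lambda>n. ereal (d X Y n)) \<le> 0"
      proof (rule ccontr)
        assume "\<not> ?thesis"
        then obtain y where y: "ereal y < liminf (\<lambda>n. ereal (d X Y n))" "0 < ereal y"
          unfolding not_le using ereal_dense2 by blast
        from less_LiminfD[OF y(1)] obtain N where N: "\<And>n. n \<ge> N \<Longrightarrow> y < d X Y n"
          by (auto simp: eventually_sequentially)
        have "0 < y"
          using y(2) by simp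
        then obtain i where "i \<ge> N" "d X Y i < y"
          using frequently_in_blocks[OF L near] by blast
        then show False
          using N[of i] by simp
      qed
    qed
    show "ereal (\<delta> / 2) < limsup (\<lambda>n. ereal (dist (iter f 0 n p) (iter f 0 n q)))"
      unfolding pq d_def[symmetric]
    proof (rule ccontr)
      assume "\<not> ereal (\<delta> / 2) < limsup (\<lambda>n. ereal (d X Y n))"
      moreover have "ereal (\<delta> / 2) < ereal \<delta>"
        using \<delta> by simp
      ultimately have "limsup (\<lambda>n. ereal (d X Y n)) < ereal \<delta>"
        unfolding not_less by (rule le_less_trans)
      from Limsup_lessD[OF this] obtain N where N: "\<And>n. n \<ge> N \<Longrightarrow> d X Y n < \<delta>"
        by (auto simp: eventually_sequentially)
      obtain i where "i \<ge> N" "d X Y i \<ge> \<delta>"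
        using frequently_in_blocks[OF L far[OF pq(3)]] by blast
      then show False
        using N[of i] by simp
    qed
  qed
  moreover have "distributionally_chaotic f"
    unfolding distributionally_chaotic_def
  proof (intro exI[of _ "range x"] conjI S ballI impI)
    fix p q assume "p \<in> range x" "q \<in> range x" "p \<noteq> q"
    then obtain X Y where pq: "p = x X" "q = x Y" "X \<noteq> Y"
      by blast
    \<comment> \<open>Frequencies become averages of indicators. These are constantly 1 on the
      blocks where orbits are close and, for the threshold \<open>\<delta>\<close>, constantly 0 on
      the blocks where they are apart.\<close>
    have freq: "close_frequency f p q e = (\<lambda>n. 1 / real n * (\<Sum>i<n. indicator {0..<e} (d X Y i)))" for e
      by (simp add: close_frequency_def pq d_def fun_eq_iff)
    show "\<forall>e>0. limsup (\<lambda>n. ereal (close_frequency f p q e n)) = 1"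
      unfolding freq
    proof (intro allI impI limsup_average_eq_1[OF L])
      fix e :: real and M assume "e > 0"
      from near[OF this, of M X Y] obtain m where "m \<ge> M"
          "\<forall>i. L * fact m \<le> i \<and> i < L * m * fact m \<longrightarrow> d X Y i < e"
        by blast
      then show "\<exists>m\<ge>M. \<forall>i. L * fact m \<le> i \<and> i < L * m * fact m \<longrightarrow> indicator {0..<e} (d X Y i) = (1 :: real)"
        by (intro exI[of _ m]) (simp add: indicator_def d_def)
    qed (auto simp: indicator_def)
    show "\<exists>e>0. liminf (\<lambda>n. ereal (close_frequency f p q e n)) = 0"
      unfolding freq
    proof (intro exI[of _ \<delta>] conjI \<delta> liminf_average_eq_0[OF L])
      fix M
      from far[OF pq(3), of M] obtain m where "m \<ge> M"
          "\<forall>i. L * fact m \<le> i \<and> i < L * m * fact m \<longrightarrow> \<delta> \<le> d X Y i"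
        by blast
      then show "\<exists>m\<ge>M. \<forall>i. L * fact m \<le> i \<and> i < L * m * fact m \<longrightarrow> indicator {0..<\<delta>} (d X Y i) = (0 :: real)"
        by (intro exI[of _ m]) (simp add: indicator_def not_less)
    qed (auto simp: indicator_def)
  qed
  ultimately show ?thesis
    using \<delta> half_gt_zero by blast
qed

end

theorem theorem3p6:
  fixes f :: "nat \<Rightarrow> 'a::metric_space \<Rightarrow> 'a"
    and A :: "real^'n^'n"
    and V :: "'n \<Rightarrow> 'a set"
    and W :: "'n \<Rightarrow> nat \<Rightarrow> 'a set"
  assumes "transition_matrix A"
    and "\<And>i. V i \<noteq> {}"
    and "\<And>i j. i \<noteq> j \<Longrightarrow> setdist (V i) (V j) > 0"
    and "\<And>i n. W i n \<noteq> {}"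
    and "\<And>i n. compact (W i n)"
    and "\<And>i n. W i n \<subseteq> V i"
    and "equi_continuous_on dist dist (\<lambda>_. \<Union>n. \<Union>i. W i n) f"
    and "\<And>\<alpha> m n. \<alpha> \<in> subshift A \<Longrightarrow> itinerary_set f W \<alpha> m n \<noteq> {}"
    and "\<And>\<alpha>. \<alpha> \<in> subshift A \<Longrightarrow>
           uniform_limit UNIV (\<lambda>m n. diameter (itinerary_set f W \<alpha> m n)) (\<lambda>_. 0) sequentially"
  shows "(\<exists>\<Lambda>. (\<forall>n. \<Lambda> n \<noteq> {} \<and> compact (\<Lambda> n) \<and> \<Lambda> n \<subseteq> (\<Union>i. W i n) \<and> f n ` \<Lambda> n = \<Lambda> (Suc n)) \<and>
              equi_conjugate_to_subshift f \<Lambda> A \<and>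
              (compact (UNIV :: 'a set) \<longrightarrow>
                 topological_entropy f (\<Lambda> 0) = ereal (ln (matrix_rho A)))) \<and>
         (irreducible_matrix A \<and> (\<exists>i. (\<Sum>j\<in>UNIV. A $ i $ j) \<ge> 2) \<longrightarrow>
            (\<exists>\<delta>>0. li_yorke_chaotic \<delta> f) \<and> distributionally_chaotic f)"
proof (intro conjI impI)
  interpret itinerary_system f A V W
    using assms by unfold_locales
  show "\<exists>\<Lambda>. (\<forall>n. \<Lambda> n \<noteq> {} \<and> compact (\<Lambda> n) \<and> \<Lambda> n \<subseteq> (\<Union>i. W i n) \<and> f n ` \<Lambda> n = \<Lambda> (Suc n)) \<and>
      equi_conjugate_to_subshift f \<Lambda> A \<and>
      (compact (UNIV :: 'a set) \<longrightarrow> topological_entropy f (\<Lambda> 0) = ereal (ln (matrix_rho A)))"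
    by (intro exI[of _ limit_set] conjI allI impI limit_set_nonempty compact_limit_set limit_set_subset
        f_image_limit_set equi_conjugate_limit_set topological_entropy_limit_set)
  assume "irreducible_matrix A \<and> (\<exists>i. (\<Sum>j\<in>UNIV. A $ i $ j) \<ge> 2)"
  then show "\<exists>\<delta>>0. li_yorke_chaotic \<delta> f" "distributionally_chaotic f"
    using chaotic by blast+
qed

end
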